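(* Let $X_1,X_2,\ldots$ be independent mean zero random variables such that $\mathrm{Var}(X_i)=\sigma_i^2$. Let $W=\sum_{i=1}^NX_i$, where $N$ is a discrete random variable whose support is a subset of $\{0,1,2,\ldots\}$, independent of $\{X_i\}_{i=1}^\infty$. Define $\sigma^2:=\mathrm{Var}(W)=\sum_{i=1}^\infty\sigma_i^2P(N\ge i)$. Let $I$ be a random index with values in $\{1,2,\ldots\}$, independent of $N$ and of all $X_i$, with $P(I=i)=\sigma_i^2P(N\ge i)/\sigma^2$. Then $$d_1\big(\mathcal{L}(W/\sigma),\mathcal{L}(Z)\big)\le\frac1{\sigma^3}\sum_{i=1}^\infty\left(\mathbb{E}|X_i|^3+2\sigma_i^2\,\mathbb{E}|X_i|\right)P(N\ge i)^2+2\sqrt{\frac2\pi}\;P(N<I),$$ where $Z$ is a standard normal random variable.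
   Context: $\mathcal{L}(X)$ denotes the distribution of $X$. The $L^1$ (Wasserstein) distance is $d_1(\mathcal{L}(X),\mathcal{L}(Y))=\int_{-\infty}^\infty|P(X\le t)-P(Y\le t)|\,dt=\sup_{h}|\mathbb{E}h(X)-\mathbb{E}h(Y)|$, the supremum being over all $h:\mathbb{R}\to\mathbb{R}$ with $|h(y)-h(x)|\le|y-x|$ for all $x,y$. The definition of $I$ presupposes $0<\sigma^2<\infty$. *)

theory Defs
  imports "HOL-Probability.Probability"
begin

text \<open>
  Independence of two random elements taking values in different types; the library's
  \<^const>\<open>prob_space.indep_var\<close> requires both to have the same value type.
\<close>

definition indep_elements ::
  "'a measure \<Rightarrow> 'b measure \<Rightarrow> ('a \<Rightarrow> 'b) \<Rightarrow> 'c measure \<Rightarrow> ('a \<Rightarrow> 'c) \<Rightarrow> bool" where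
  "indep_elements M S X T Y \<longleftrightarrow>
     X \<in> measurable M S \<and> Y \<in> measurable M T \<and>
     prob_space.indep_set M {X -` A \<inter> space M | A. A \<in> sets S} {Y -` B \<inter> space M | B. B \<in> sets T}"

text \<open>
  The \<open>L\<^sup>1\<close> (Wasserstein) distance of two laws on the real line, as an extended nonnegative real
  since it may be infinite for laws without a first moment.
\<close>

definition wasserstein_dist :: "real measure \<Rightarrow> real measure \<Rightarrow> ennreal" where
  "wasserstein_dist \<mu> \<nu> = (\<integral>\<^sup>+ t. ennreal \<bar>cdf \<mu> t - cdf \<nu> t\<bar> \<partial>lborel)"

end

theory Submission
  imports Defs "HOL-Real_Asymp.Real_Asymp"
begin

text \<open>
  Stein's method. The distance equals the supremum of \<open>\<integral> s t * (\<Phi> t - F t) dt\<close> over continuous \<open>s\<close> with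
  \<open>\<bar>s\<bar> \<le> 1\<close>, and each such integral is \<open>E (f' V - V * f V)\<close> for the solution \<open>f\<close> of Stein's equation,
  where \<open>V = W / \<sigma>\<close>, \<open>\<bar>f'\<bar> \<le> sqrt (2 / \<pi>)\<close> and \<open>\<bar>f''\<bar> \<le> 2\<close>.
  Conditioning on \<open>N\<close> splits \<open>E (W * f V)\<close> into the terms \<open>E (X\<^sub>i * f V; N \<ge> i)\<close>, which are compared with
  \<open>\<sigma>\<^sub>i\<^sup>2 * P (N \<ge> i) * E (f' V)\<close>. A fraction \<open>P (N \<ge> i)\<close> of each term is estimated by a second-order
  Taylor expansion of \<open>f\<close>; the remaining fraction \<open>P (N < i)\<close> is bounded by means of \<open>\<bar>f'\<bar>\<close> alone,
  and contributes \<open>P (N < I)\<close>. No zero-bias coupling has to be constructed.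
\<close>

section \<open>The standard normal distribution\<close>

text \<open>The obstacle is that \<open>N\<close> and \<open>W\<close> are dependent. Write
  \<open>q = P (N \<ge> i)\<close> and \<open>v\<close> for the variance of
  \<open>X\<^sub>i\<close>. Taylor expansion compares \<open>E (X\<^sub>i * f V; N \<ge> i)\<close>
  with \<open>v * E (f' V; N \<ge> i)\<close>, whereas Stein's equation calls for
  \<open>v * q * E (f' V)\<close>; up to scaling, passing between these two costs at most
  \<open>2 * L * v * q * (1 - q)\<close>, where \<open>L\<close> bounds
  \<open>\<bar>f'\<bar>\<close>. A full expansion would leave the third moments with weight
  \<open>q\<close>. The weight becomes \<open>q\<^sup>2\<close> at no extra cost, because the
  unexpanded term obeys the same bound \<open>L * v * q\<close> as its approximation: a fraction
  \<open>1 - q\<close> of it is estimated crudely within the loss already incurred. As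
  \<open>I\<close> is independent of \<open>N\<close>, the sum of \<open>v * q * (1 - q)\<close> is
  \<open>\<sigma>\<^sup>2 * P (N < I)\<close>; the factor \<open>2 * sqrt (2 / \<pi>)\<close> is
  twice the bound on \<open>f'\<close>, which is why that bound must be sharp. The function
  \<open>s\<close> is taken continuous because \<open>f''\<close> contains \<open>s\<close> and has
  to exist at every point.\<close>

abbreviation (input) \<phi> :: "real \<Rightarrow> real" where "\<phi> \<equiv> std_normal_density"

abbreviation (input) \<Phi> :: "real \<Rightarrow> real" where "\<Phi> \<equiv> cdf std_normal_distribution"

lemma std_normal_density_has_derivative: "(\<phi> has_real_derivative - x * \<phi> x) (at x)"
  unfolding std_normal_density_def
  by (auto intro!: derivative_eq_intros simp: field_simps)

lemma std_normal_density_has_derivative' [derivative_intros]: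
  "(g has_real_derivative g') (at x) \<Longrightarrow>
   ((\<lambda>x. \<phi> (g x)) has_real_derivative - g x * \<phi> (g x) * g') (at x)"
  using DERIV_chain2[OF std_normal_density_has_derivative] by blast

lemma std_normal_density_pos [simp]: "\<phi> x > 0"
  by (simp add: normal_density_pos)

lemma std_normal_density_nonzero [simp]: "\<phi> x \<noteq> 0"
  using std_normal_density_pos[of x] by linarith

lemma std_normal_density_minus: "\<phi> (-x) = \<phi> x"
  by (simp add: std_normal_density_def)

lemma continuous_on_std_normal_density: "continuous_on A \<phi>"
  unfolding std_normal_density_def by (intro continuous_intros) auto

text \<open>Near \<open>w\<close> only the part of the integral over \<open>[w - 1, x]\<close>
  varies; the tail up to \<open>w - 1\<close> is constant, which leaves the fundamental theorem of
  calculus on a compact interval.\<close>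

lemma set_integral_atMost_has_derivative:
  fixes g :: "real \<Rightarrow> real"
  assumes cont: "continuous_on UNIV g" and int: "\<And>w. set_integrable lborel {..w} g"
  shows "((\<lambda>w. LINT t:{..w}|lborel. g t) has_real_derivative g w) (at w)"
proof -
  define F where "F x = (LINT t:{..w - 1}|lborel. g t) + integral {w - 1..x} g" for x
  have sub: "set_integrable lborel {w - 1..x} g" for x
    by (rule set_integrable_subset[OF int[of x]]) auto
  have sub': "set_integrable lborel {w - 1<..x} g" for x
    by (rule set_integrable_subset[OF int[of x]]) auto
  have eq: "(LINT t:{..x}|lborel. g t) = F x" if "x > w - 1" for x
  proof -
    have Un: "{..x} = {..w - 1} \<union> {w - 1<..x}" using that by auto
    have "(LINT t:{..x}|lborel. g t) = (LINT t:{..w - 1}|lborel. g t) + (LINT t:{w - 1<..x}|lborel. g t)"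
      unfolding Un by (rule set_integral_Un[OF _ int sub']) auto
    also have "(LINT t:{w - 1<..x}|lborel. g t) = (LINT t:{w - 1..x}|lborel. g t)"
      by (rule set_integral_discrete_difference[where X = "{w - 1}"]) auto
    also have "\<dots> = integral {w - 1..x} g"
      by (rule set_borel_integral_eq_integral[OF sub])
    finally show ?thesis by (simp add: F_def)
  qed
  have "((\<lambda>x. integral {w - 1..x} g) has_real_derivative g w) (at w within {w - 1..w + 1})"
    by (rule integral_has_real_derivative) (use cont continuous_on_subset in auto)
  hence "((\<lambda>x. integral {w - 1..x} g) has_real_derivative g w) (at w)"
    by (simp add: at_within_Icc_at)
  hence "(F has_real_derivative g w) (at w)"
    unfolding F_def by (auto intro!: derivative_eq_intros)
  thus ?thesis
    by (rule has_field_derivative_transform_within_open[where S = "{w - 1<..}"]) (auto simp: eq)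
qed

interpretation std_normal: real_distribution std_normal_distribution
  by (rule real_dist_normal_dist)

lemma std_normal_cdf_eq: "\<Phi> x = (LINT t:{..x}|lborel. \<phi> t)"
proof -
  have "\<Phi> x = (LINT t|std_normal_distribution. indicator {..x} t)"
    by (simp add: cdf_def)
  also have "\<dots> = (LINT t:{..x}|lborel. \<phi> t)"
    by (subst integral_density) (auto simp: set_lebesgue_integral_def mult.commute)
  finally show ?thesis .
qed

lemma std_normal_density_set_integrable: "A \<in> sets borel \<Longrightarrow> set_integrable lborel A \<phi>"
  unfolding set_integrable_def
  by (intro integrable_mult_indicator) auto

lemma std_normal_cdf_has_derivative: "(\<Phi> has_real_derivative \<phi> x) (at x)"
proof -
  have "\<Phi> = (\<lambda>x. LINT t:{..x}|lborel. \<phi> t)"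
    by (simp add: fun_eq_iff std_normal_cdf_eq)
  thus ?thesis
    using set_integral_atMost_has_derivative[of \<phi> x]
    by (simp add: continuous_on_std_normal_density std_normal_density_set_integrable)
qed

lemma std_normal_cdf_has_derivative' [derivative_intros]:
  "(g has_real_derivative g') (at x) \<Longrightarrow>
   ((\<lambda>x. \<Phi> (g x)) has_real_derivative \<phi> (g x) * g') (at x)"
  using DERIV_chain2[OF std_normal_cdf_has_derivative] by blast

lemma continuous_on_std_normal_cdf: "continuous_on A \<Phi>"
  by (intro continuous_at_imp_continuous_on ballI DERIV_isCont[OF std_normal_cdf_has_derivative])

lemma measurable_std_normal_cdf [measurable]: "\<Phi> \<in> borel_measurable borel"
  by (intro borel_measurable_continuous_onI continuous_on_std_normal_cdf)

lemma std_normal_cdf_minus: "\<Phi> (-x) = 1 - \<Phi> x"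
proof -
  let ?g = "\<lambda>x. \<Phi> x + \<Phi> (-x)"
  \<comment> \<open>The sum is constant because the density is even; the constant is read off at
    infinity.\<close>
  have "\<exists>c. \<forall>x\<in>UNIV. ?g x = c"
    by (rule has_field_derivative_zero_constant)
       (auto intro!: derivative_eq_intros simp: std_normal_density_minus)
  then obtain c where c: "\<And>x. ?g x = c" by auto
  have "(?g \<longlongrightarrow> 1 + 0) at_top"
    using std_normal.cdf_lim_at_top_prob std_normal.cdf_lim_at_bot
    by (intro tendsto_add) (simp_all add: filterlim_at_bot_mirror)
  hence "c = 1"
    by (simp add: c tendsto_const_iff)
  thus ?thesis using c[of x] by simp
qed

lemma std_normal_cdf_nonneg: "\<Phi> x \<ge> 0"
  by (simp add: cdf_def)

lemma std_normal_cdf_le_1: "\<Phi> x \<le> 1"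
  by (simp add: std_normal.cdf_bounded_prob)

lemma std_normal_density_tendsto_0: "(\<phi> \<longlongrightarrow> 0) at_top"
  unfolding std_normal_density_def by real_asymp

lemma std_normal_cdf_tendsto_0: "((\<lambda>x. \<Phi> (- x)) \<longlongrightarrow> 0) at_top"
  using std_normal.cdf_lim_at_bot by (simp add: filterlim_at_bot_mirror)

text \<open>The difference \<open>\<Phi> (- x) - x / (1 + x\<^sup>2) * \<phi> x\<close> decreases
  strictly to the limit 0, so it is positive on the whole line. This provides the sign of the
  coefficients in the bound on the second derivative of the Stein solution.\<close>

lemma Mills_ratio_lower: "(1 + x\<^sup>2) * \<Phi> (- x) \<ge> x * \<phi> x"
proof -
  let ?m = "\<lambda>x. \<Phi> (-x) - x / (1 + x\<^sup>2) * \<phi> x"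
  have nz: "1 + x\<^sup>2 \<noteq> 0" for x :: real
    by (metis add.commute power_one sum_power2_eq_zero_iff zero_neq_one)
  have "((\<lambda>x. x / (1 + x\<^sup>2) * \<phi> x) \<longlongrightarrow> 0) at_top"
    unfolding std_normal_density_def by real_asymp
  from tendsto_diff[OF std_normal_cdf_tendsto_0 this]
  have lim: "(?m \<longlongrightarrow> 0) at_top" by simp
  have "0 < ?m x"
  proof (rule DERIV_neg_imp_decreasing_at_top[OF _ lim])
    fix y
    have "(?m has_real_derivative - \<phi> y - ((\<phi> y - y * \<phi> y * y) * (1 + y\<^sup>2) - y * \<phi> y * (2 * y)) /
        ((1 + y\<^sup>2) * (1 + y\<^sup>2))) (at y)"
      by (auto intro!: derivative_eq_intros simp: std_normal_density_minus nz)
    also have "- \<phi> y - ((\<phi> y - y * \<phi> y * y) * (1 + y\<^sup>2) - y * \<phi> y * (2 * y)) /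
        ((1 + y\<^sup>2) * (1 + y\<^sup>2)) = - 2 * \<phi> y / (1 + y\<^sup>2)\<^sup>2"
      using nz[of y] by (simp add: divide_simps) (simp add: algebra_simps power2_eq_square)
    finally have "(?m has_real_derivative - 2 * \<phi> y / (1 + y\<^sup>2)\<^sup>2) (at y)" .
    thus "\<exists>d. (?m has_real_derivative d) (at y) \<and> d < 0"
      using nz[of y] by (intro exI[of _ "- 2 * \<phi> y / (1 + y\<^sup>2)\<^sup>2"]) (auto simp: field_simps)
  qed
  hence "x / (1 + x\<^sup>2) * \<phi> x < \<Phi> (-x)" by simp
  hence "(1 + x\<^sup>2) * (x / (1 + x\<^sup>2) * \<phi> x) \<le> (1 + x\<^sup>2) * \<Phi> (-x)"
    by (intro mult_left_mono) auto
  thus ?thesis using nz[of x] by simp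
qed

text \<open>For positive \<open>x\<close> the quotient form decreases to 0; otherwise the left side
  is not positive. The difference \<open>\<phi> w - w * \<Phi> (- w)\<close> is the upper tail
  \<open>\<Phi> (- t)\<close> integrated over \<open>t \<ge> w\<close>, and its nonnegativity is
  used throughout.\<close>

lemma Mills_ratio_upper: "x * \<Phi> (- x) \<le> \<phi> x"
proof (cases "x > 0")
  case True
  let ?m = "\<lambda>x. \<phi> x / x - \<Phi> (-x)"
  have "((\<lambda>x. \<phi> x / x) \<longlongrightarrow> 0) at_top"
    unfolding std_normal_density_def by real_asymp
  from tendsto_diff[OF this std_normal_cdf_tendsto_0]
  have lim: "(?m \<longlongrightarrow> 0) at_top" by simp
  have "0 < ?m x"
  proof (rule DERIV_neg_imp_decreasing_at_top[OF _ lim])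
    fix y assume "y \<ge> x"
    hence y: "y > 0" using True by simp
    have "(?m has_real_derivative - \<phi> y / y\<^sup>2) (at y)"
      using y by (auto intro!: derivative_eq_intros simp: std_normal_density_minus field_simps power2_eq_square) 
    thus "\<exists>d. (?m has_real_derivative d) (at y) \<and> d < 0"
      using y by (intro exI[of _ "- \<phi> y / y\<^sup>2"]) (auto simp: field_simps)
  qed
  thus ?thesis using True by (simp add: field_simps)
next
  case False
  hence "x * \<Phi> (-x) \<le> 0"
    using std_normal_cdf_nonneg[of "-x"] by (simp add: mult_nonpos_nonneg)
  thus ?thesis using std_normal_density_pos[of x] by linarith
qed

section \<open>Solutions of Stein's equation\<close>

lemma nn_integral_std_normal_cdf:
  "(\<integral>\<^sup>+ t. ennreal (\<Phi> t) * indicator {..w} t \<partial>lborel) = ennreal (w * \<Phi> w + \<phi> w)"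
proof -
  have "(\<integral>\<^sup>+ t. ennreal (\<Phi> t) * indicator {..w} t \<partial>lborel)
      = (\<integral>\<^sup>+ t. ennreal (\<Phi> (- t)) * indicator {..w} (- t) \<partial>lborel)"
    by (subst nn_integral_real_affine[where c = "-1" and t = 0]) auto
  also have "\<dots> = (\<integral>\<^sup>+ t. ennreal (\<Phi> (- t)) * indicator {-w..} t \<partial>lborel)"
    by (intro nn_integral_cong) (auto simp: indicator_def)
  also have "\<dots> = ennreal (0 - ((- w) * \<Phi> (- (- w)) - \<phi> (- w)))"
  \<comment> \<open>In the derivative of \<open>t * \<Phi> (- t) - \<phi> t\<close> the terms
    \<open>t * \<phi> t\<close> cancel. This antiderivative vanishes at infinity, being squeezed
    between \<open>- \<phi> t\<close> and 0.\<close>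
  proof (rule nn_integral_FTC_atLeast)
    show "((\<lambda>t. t * \<Phi> (- t) - \<phi> t) has_real_derivative \<Phi> (- x)) (at x)" for x
      by (auto intro!: derivative_eq_intros simp: std_normal_density_minus)
    show "((\<lambda>t. t * \<Phi> (- t) - \<phi> t) \<longlongrightarrow> 0) at_top"
    proof (rule tendsto_sandwich[where f = "\<lambda>t. - \<phi> t" and h = "\<lambda>_. 0"])
      show "\<forall>\<^sub>F t in at_top. - \<phi> t \<le> t * \<Phi> (- t) - \<phi> t"
        using eventually_ge_at_top[of 0] by eventually_elim (simp add: std_normal_cdf_nonneg)
      show "\<forall>\<^sub>F t in at_top. t * \<Phi> (- t) - \<phi> t \<le> 0"
        using Mills_ratio_upper by (intro always_eventually) simp
      show "((\<lambda>t. - \<phi> t) \<longlongrightarrow> 0) at_top"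
        using tendsto_minus[OF std_normal_density_tendsto_0] by simp
    qed simp
  qed (auto simp: std_normal_cdf_nonneg)
  finally show ?thesis by (simp add: std_normal_density_minus add.commute)
qed

lemma std_normal_cdf_integral_nonneg: "0 \<le> w * \<Phi> w + \<phi> w"
  using Mills_ratio_upper[of "-w"] by (simp add: std_normal_density_minus)

text \<open>If \<open>h' = s\<close>, then \<open>h w - E (h Z)\<close> is the integral of
  \<open>s * \<Phi>\<close> up to \<open>w\<close> minus that of \<open>s * (1 - \<Phi>)\<close>
  beyond \<open>w\<close>. This is the first part. Only \<open>s\<close> enters, so no test function
  \<open>h\<close> has to be constructed.\<close>

definition std_normal_cdf_integral :: "(real \<Rightarrow> real) \<Rightarrow> real \<Rightarrow> real" where
  "std_normal_cdf_integral s w = (LINT t:{..w}|lborel. s t * \<Phi> t)"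

lemma
  assumes [measurable]: "s \<in> borel_measurable borel" and s: "\<And>t. \<bar>s t\<bar> \<le> 1"
  shows std_normal_cdf_set_integrable: "set_integrable lborel {..w} (\<lambda>t. s t * \<Phi> t)"
    and abs_std_normal_cdf_integral_le: "\<bar>std_normal_cdf_integral s w\<bar> \<le> w * \<Phi> w + \<phi> w"
proof -
  have le: "norm (indicator {..w} t *\<^sub>R (s t * \<Phi> t)) \<le> \<Phi> t * indicator {..w} t" for t
    using s[of t] std_normal_cdf_nonneg[of t] by (auto simp: indicator_def abs_mult mult_left_le_one_le)
  have bi: "has_bochner_integral lborel (\<lambda>t. \<Phi> t * indicator {..w} t) (w * \<Phi> w + \<phi> w)"
    using nn_integral_std_normal_cdf[of w] std_normal_cdf_integral_nonneg[of w]
    by (intro has_bochner_integral_nn_integral)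
       (auto simp: std_normal_cdf_nonneg ennreal_mult' ennreal_indicator)
  show int: "set_integrable lborel {..w} (\<lambda>t. s t * \<Phi> t)"
    unfolding set_integrable_def using le
    by (intro Bochner_Integration.integrable_bound[OF integrable.intros[OF bi]]) (auto intro: order_trans[OF _ abs_ge_self])
  have "norm (std_normal_cdf_integral s w) \<le> (\<integral>t. \<Phi> t * indicator {..w} t \<partial>lborel)"
    unfolding std_normal_cdf_integral_def set_lebesgue_integral_def
    by (rule Bochner_Integration.integral_norm_bound_integral[OF _ integrable.intros[OF bi]])
       (use int le in \<open>auto simp: set_integrable_def\<close>)
  thus "\<bar>std_normal_cdf_integral s w\<bar> \<le> w * \<Phi> w + \<phi> w"
    using has_bochner_integral_integral_eq[OF bi] by simp
qed

text \<open>
  Here \<open>s\<close> is the derivative of the Lipschitz test function \<open>h\<close>, and \<open>stein_rhs s w = h w - E (h Z)\<close>.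
  The integral of \<open>s * (1 - \<Phi>)\<close> over \<open>[w, \<infinity>)\<close> is written as an integral over \<open>(-\<infinity>, -w]\<close> by reflection.
\<close>

definition stein_rhs :: "(real \<Rightarrow> real) \<Rightarrow> real \<Rightarrow> real" where
  "stein_rhs s w = std_normal_cdf_integral s w - std_normal_cdf_integral (\<lambda>t. s (- t)) (- w)"

text \<open>The classical solution is \<open>1 / \<phi> w\<close> times the integral of
  \<open>(h - E (h Z)) * \<phi>\<close> up to \<open>w\<close>; integration by parts replaces
  \<open>h\<close> by its derivative \<open>s\<close> and gives this form.\<close>

definition stein_sol :: "(real \<Rightarrow> real) \<Rightarrow> real \<Rightarrow> real" where
  "stein_sol s w = - (\<Phi> (- w) / \<phi> w) * std_normal_cdf_integral s w
     - (\<Phi> w / \<phi> w) * std_normal_cdf_integral (\<lambda>t. s (- t)) (- w)"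

text \<open>Stein's equation serves as the definition; that the result is the derivative of
  \<open>stein_sol s\<close> is proved afterwards.\<close>

definition stein_deriv :: "(real \<Rightarrow> real) \<Rightarrow> real \<Rightarrow> real" where
  "stein_deriv s w = stein_rhs s w + w * stein_sol s w"

section \<open>The sharp bound on the product of the two integrated tails\<close>

lemma sqrt_diff_quotient_tendsto_at_right:
  fixes c :: real assumes c: "c > 0"
  shows "((\<lambda>w. (sqrt (c * (c * exp (- w\<^sup>2 / 2)) + w\<^sup>2 / 4) - c * exp (- w\<^sup>2 / 2)) / w) \<longlongrightarrow> 0) (at_right 0)"
proof -
  let ?N = "\<lambda>w. sqrt (c * (c * exp (- w\<^sup>2 / 2)) + w\<^sup>2 / 4) - c * exp (- w\<^sup>2 / 2)"
  \<comment> \<open>The numerator vanishes at 0 together with its derivative, so the quotient by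
    \<open>w\<close> is a difference quotient with limit 0.\<close>
  have "(?N has_real_derivative 0) (at 0)"
    using c by (auto intro!: derivative_eq_intros)
  hence "((\<lambda>w. ?N w / w) \<longlongrightarrow> 0) (at 0)"
    using c by (simp add: has_field_derivative_iff)
  thus ?thesis by (rule tendsto_within_subset) auto
qed

lemma sqrt_diff_quotient_tendsto_at_top:
  fixes c :: real assumes "c > 0"
  shows "((\<lambda>w. (sqrt (c * (c * exp (- w\<^sup>2 / 2)) + w\<^sup>2 / 4) - c * exp (- w\<^sup>2 / 2)) / w) \<longlongrightarrow> 1/2) at_top"
  using assms by (real_asymp simp: powr_half_sqrt real_sqrt_divide)

lemma std_normal_cdf_0: "\<Phi> 0 = 1 / 2"
  using std_normal_cdf_minus[of 0] by simp

lemma std_normal_density_eq: "\<phi> w = \<phi> 0 * exp (- w\<^sup>2 / 2)"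
  by (simp add: std_normal_density_def)

lemma std_normal_density_0: "\<phi> 0 = 1 / sqrt (2 * pi)"
  by (simp add: std_normal_density_def)

text \<open>The second derivative of \<open>g\<close> is \<open>exp (- y / 2) - 2\<close>, so
  \<open>g\<close> is concave on \<open>[0, \<infinity>)\<close>; as \<open>g 0 = 0\<close>, it
  follows that \<open>g y\<close> is at least \<open>y / z * g z\<close>. Hence \<open>g\<close> can
  only pass from nonnegative to negative values.\<close>

lemma exp_concave_sign:
  fixes y z c :: real
  defines "g \<equiv> \<lambda>y. 4 * exp (- y / 2) + c * y - (2 + y)\<^sup>2"
  assumes "0 \<le> y" "y \<le> z" "g z \<ge> 0"
  shows "g y \<ge> 0"
proof (cases "z = 0")
  case False
  have "convex_on {0..} (\<lambda>y. - g y)"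
  proof (rule f''_ge0_imp_convex)
    show "((\<lambda>y. - g y) has_real_derivative 2 * exp (- x / 2) - c + 2 * (2 + x)) (at x)" for x
      unfolding g_def by (auto intro!: derivative_eq_intros)
    show "((\<lambda>x. 2 * exp (- x / 2) - c + 2 * (2 + x)) has_real_derivative - exp (- x / 2) + 2) (at x)" for x
      by (auto intro!: derivative_eq_intros)
    show "- exp (- x / 2) + 2 \<ge> 0" if "x \<in> {0..}" for x :: real
      using that exp_le_one_iff[of "- x / 2"] by (simp del: exp_le_one_iff)
  qed (rule convex_real_interval)
  from convex_onD[OF this, of "y / z" 0 z] have "- g y \<le> y / z * - g z"
    using assms False by (simp add: g_def)
  moreover have "y / z * g z \<ge> 0"
    using assms False by (intro mult_nonneg_nonneg) auto
  ultimately show ?thesis by simp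
qed (use assms in auto)

text \<open>
  Put \<open>S w = sqrt (\<phi> 0 * \<phi> w + w\<^sup>2 / 4)\<close>. The claim is equivalent to \<open>(S w - \<phi> w) / w \<ge> \<Phi> w - 1 / 2\<close>
  for \<open>w > 0\<close>. The derivative of the difference has the sign of \<open>2 * S w - \<phi> 0 * (2 + w\<^sup>2)\<close>, that is, of
  a function of \<open>w\<^sup>2\<close> that is concave and vanishes at 0; hence the difference first increases
  and then decreases, and it tends to 0 at both ends.
\<close>

lemma std_normal_cdf_integral_product_le:
  "(w * \<Phi> w + \<phi> w) * (\<phi> w - w * \<Phi> (- w)) \<le> \<phi> 0 * \<phi> w"
proof -
  have pos: "(w * \<Phi> w + \<phi> w) * (\<phi> w - w * \<Phi> (- w)) \<le> \<phi> 0 * \<phi> w" if w: "w > 0" for w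
  proof -
    define S where "S w = sqrt (\<phi> 0 * \<phi> w + w\<^sup>2 / 4)" for w
    \<comment> \<open>The constant \<open>1 / 2\<close> is left out of \<open>D\<close>, so its
      limits at both ends are \<open>- 1 / 2\<close> instead of 0.\<close>
    define D where "D w = (S w - \<phi> w) / w - \<Phi> w" for w
    \<comment> \<open>Squaring removes the root from the sign condition:
      \<open>g (x\<^sup>2)\<close> is \<open>((2 * S x)\<^sup>2 - (\<phi> 0 * (2 +
      x\<^sup>2))\<^sup>2) / (\<phi> 0)\<^sup>2\<close>, and \<open>2 * pi\<close> is
      \<open>1 / (\<phi> 0)\<^sup>2\<close>.\<close>
    define g where "g y = 4 * exp (- y / 2) + 2 * pi * y - (2 + y)\<^sup>2" for y :: real
    have p0: "\<phi> 0 > 0" by simp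
    have Spos: "S x > 0" and S2: "(S x)\<^sup>2 = \<phi> 0 * \<phi> x + x\<^sup>2 / 4" for x
      by (simp_all add: S_def add_pos_nonneg)
    have sgn: "2 * S x - \<phi> 0 * (2 + x\<^sup>2) \<ge> 0 \<longleftrightarrow> g (x\<^sup>2) \<ge> 0" for x
    proof -
      have "2 * S x - \<phi> 0 * (2 + x\<^sup>2) \<ge> 0 \<longleftrightarrow> (\<phi> 0 * (2 + x\<^sup>2))\<^sup>2 \<le> (2 * S x)\<^sup>2"
        using Spos[of x] p0 by (subst power2_le_iff_abs_le) (auto simp: abs_mult)
      also have "(2 * S x)\<^sup>2 = \<phi> 0 ^ 2 * (4 * exp (- x\<^sup>2 / 2) + 2 * pi * x\<^sup>2)"
        unfolding power_mult_distrib S2 std_normal_density_eq[of x]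
        by (simp add: std_normal_density_0 field_simps power2_eq_square)
      also have "(\<phi> 0 * (2 + x\<^sup>2))\<^sup>2 \<le> \<dots> \<longleftrightarrow> (2 + x\<^sup>2)\<^sup>2 \<le> 4 * exp (- x\<^sup>2 / 2) + 2 * pi * x\<^sup>2"
        unfolding power_mult_distrib using p0 by (subst mult_le_cancel_left_pos) auto
      finally show ?thesis by (simp add: g_def)
    qed
    have D': "(D has_real_derivative \<phi> x * (2 * S x - \<phi> 0 * (2 + x\<^sup>2)) / (2 * S x * x\<^sup>2)) (at x)"
      if x: "x > 0" for x
    proof -
      have "(S has_real_derivative (- x * \<phi> 0 * \<phi> x + x / 2) / (2 * S x)) (at x)"
        unfolding S_def using Spos[of x]
        by (auto intro!: derivative_eq_intros simp: S_def field_simps)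
      note S' = this
      have "(D has_real_derivative (((- x * \<phi> 0 * \<phi> x + x / 2) / (2 * S x) + x * \<phi> x) * x
              - (S x - \<phi> x)) / (x * x) - \<phi> x) (at x)"
        unfolding D_def using x by (auto intro!: derivative_eq_intros S')
      also have "(((- x * \<phi> 0 * \<phi> x + x / 2) / (2 * S x) + x * \<phi> x) * x - (S x - \<phi> x)) / (x * x) - \<phi> x
          = (- x\<^sup>2 * \<phi> 0 * \<phi> x + x\<^sup>2 / 2 + 2 * S x * \<phi> x - 2 * (S x)\<^sup>2) / (2 * S x * x\<^sup>2)"
        using x Spos[of x] by (simp add: divide_simps) (simp add: algebra_simps power2_eq_square)
      also have "- x\<^sup>2 * \<phi> 0 * \<phi> x + x\<^sup>2 / 2 + 2 * S x * \<phi> x - 2 * (S x)\<^sup>2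
          = \<phi> x * (2 * S x - \<phi> 0 * (2 + x\<^sup>2))"
        unfolding S2 by (simp add: algebra_simps)
      finally show ?thesis .
    qed
    have "D w \<ge> - 1 / 2"
    \<comment> \<open>The sign decides which end to compare with: either \<open>D\<close> increases
      on all of \<open>(0, w]\<close>, or it decreases on \<open>[w, \<infinity>)\<close>.\<close>
    proof (cases "g (w\<^sup>2) \<ge> 0")
      case True
      have le: "D x \<le> D w" if x: "0 < x" "x \<le> w" for x
      proof (rule DERIV_nonneg_imp_nondecreasing[OF x(2)])
        fix y assume y: "x \<le> y" "y \<le> w"
        have "g (y\<^sup>2) \<ge> 0"
          using True x y unfolding g_def by (intro exp_concave_sign[of "y\<^sup>2" "w\<^sup>2"]) auto
        moreover have y0: "y > 0" using w x y by linarith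
        ultimately have "\<phi> y * (2 * S y - \<phi> 0 * (2 + y\<^sup>2)) / (2 * S y * y\<^sup>2) \<ge> 0"
          using Spos[of y] sgn[of y] by (auto intro!: divide_nonneg_pos mult_nonneg_nonneg)
        thus "\<exists>d. (D has_real_derivative d) (at y) \<and> d \<ge> 0"
          using D'[OF y0] by blast
      qed
      have "(\<Phi> \<longlongrightarrow> \<Phi> 0) (at_right 0)"
        using DERIV_isCont[OF std_normal_cdf_has_derivative[of 0]]
        by (auto simp: isCont_def intro: tendsto_within_subset)
      hence "((\<lambda>x. (S x - \<phi> x) / x - \<Phi> x) \<longlongrightarrow> 0 - \<Phi> 0) (at_right 0)"
        using sqrt_diff_quotient_tendsto_at_right[OF p0, folded std_normal_density_eq]
        by (intro tendsto_diff) (simp_all add: S_def)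
      hence "(D \<longlongrightarrow> - 1 / 2) (at_right 0)"
        by (simp add: D_def[abs_def] std_normal_cdf_0)
      moreover have "\<forall>\<^sub>F x in at_right 0. D x \<le> D w"
        using eventually_at_right[of 0 1] w le by (auto simp: eventually_at_right intro!: exI[of _ w])
      ultimately show ?thesis
        by (intro tendsto_upperbound[of D]) auto
    next
      case False
      have le: "D x \<le> D w" if x: "w \<le> x" for x
      proof (rule DERIV_nonpos_imp_nonincreasing[OF x(1)])
        fix y assume y: "w \<le> y" "y \<le> x"
        have "\<not> g (y\<^sup>2) \<ge> 0"
          using False w y unfolding g_def by (metis exp_concave_sign[of "w\<^sup>2" "y\<^sup>2"] zero_le_power2 power_mono less_imp_le)
        moreover have y0: "y > 0" using w  y by linarith
        ultimately have "\<phi> y * (2 * S y - \<phi> 0 * (2 + y\<^sup>2)) / (2 * S y * y\<^sup>2) \<le> 0"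
          using Spos[of y] sgn[of y] by (auto intro!: divide_nonpos_pos mult_nonneg_nonpos)
        thus "\<exists>d. (D has_real_derivative d) (at y) \<and> d \<le> 0"
          using D'[OF y0] by blast
      qed
      have "((\<lambda>x. (S x - \<phi> x) / x - \<Phi> x) \<longlongrightarrow> 1 / 2 - 1) at_top"
        using sqrt_diff_quotient_tendsto_at_top[OF p0, folded std_normal_density_eq] std_normal.cdf_lim_at_top_prob
        by (intro tendsto_diff) (simp_all add: S_def)
      hence "(D \<longlongrightarrow> - 1 / 2) at_top"
        by (simp add: D_def[abs_def])
      moreover have "\<forall>\<^sub>F x in at_top. D x \<le> D w"
        using le by (auto simp: eventually_at_top_linorder)
      ultimately show ?thesis
        by (intro tendsto_upperbound[of D]) auto
    qed
    hence "(S w - \<phi> w) / w \<ge> \<Phi> w - 1 / 2" by (simp add: D_def)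
    hence 1: "\<phi> w + w * (\<Phi> w - 1 / 2) \<le> S w"
      using w by (simp add: field_simps)
    have "\<Phi> w \<ge> \<Phi> 0"
      using w by (intro std_normal.cdf_nondecreasing) simp
    hence "0 \<le> \<phi> w + w * (\<Phi> w - 1 / 2)"
      using w by (simp add: std_normal_cdf_0)
    \<comment> \<open>The square of the left side is the product in the claim plus
      \<open>w\<^sup>2 / 4\<close>, and \<open>(S w)\<^sup>2\<close> contains the same extra
      term.\<close>
    from power_mono[OF 1 this, of 2] show ?thesis
      unfolding S2 by (simp add: std_normal_cdf_minus power2_eq_square algebra_simps)
  qed
  \<comment> \<open>Negating \<open>w\<close> exchanges the two factors; at 0 both equal
    \<open>\<phi> 0\<close>.\<close>
  consider "w > 0" | "w = 0" | "- w > 0" by linarith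
  thus ?thesis
  proof cases
    case 3
    show ?thesis using pos[OF 3] by (simp add: std_normal_density_minus algebra_simps)
  qed (auto simp: pos)
qed

section \<open>Derivatives and uniform bounds of the Stein solution\<close>

context
  fixes s :: "real \<Rightarrow> real"
  assumes s_cont: "continuous_on UNIV s" and s_le_1: "\<And>t. \<bar>s t\<bar> \<le> 1"
begin

private lemma s_measurable: "s \<in> borel_measurable borel"
  by (intro borel_measurable_continuous_onI s_cont)

private lemma s_minus_cont: "continuous_on UNIV (\<lambda>t. s (- t))"
  by (rule continuous_on_compose2[OF s_cont]) (auto intro!: continuous_intros)

private abbreviation "H \<equiv> std_normal_cdf_integral s"
private abbreviation "H' \<equiv> std_normal_cdf_integral (\<lambda>t. s (- t))"

private lemma H_deriv: "(H has_real_derivative s w * \<Phi> w) (at w)"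
  unfolding std_normal_cdf_integral_def
  by (rule set_integral_atMost_has_derivative)
     (auto intro!: continuous_intros s_cont continuous_on_std_normal_cdf std_normal_cdf_set_integrable s_le_1
        borel_measurable_continuous_onI)

private lemma H'_deriv: "(H' has_real_derivative s (- w) * \<Phi> w) (at w)"
  unfolding std_normal_cdf_integral_def
  by (rule set_integral_atMost_has_derivative)
     (auto intro!: continuous_intros s_minus_cont continuous_on_std_normal_cdf std_normal_cdf_set_integrable s_le_1
        borel_measurable_continuous_onI)

private lemma H'_minus_deriv: "((\<lambda>w. H' (- w)) has_real_derivative - (s w * \<Phi> (- w))) (at w)"
  by (rule DERIV_cong[OF DERIV_chain2[OF H'_deriv]]) (auto intro!: derivative_eq_intros)

private lemma H_bound: "\<bar>H w\<bar> \<le> w * \<Phi> w + \<phi> w"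
  by (intro abs_std_normal_cdf_integral_le s_le_1 s_measurable)

private lemma H'_bound: "\<bar>H' (- w)\<bar> \<le> \<phi> w - w * \<Phi> (- w)"
  using abs_std_normal_cdf_integral_le[of "\<lambda>t. s (- t)" "- w"] s_le_1 s_minus_cont
  by (simp add: std_normal_density_minus borel_measurable_continuous_onI)

text \<open>The terms in which \<open>H\<close> and \<open>H'\<close> are differentiated cancel,
  both being \<open>s w * \<Phi> w * \<Phi> (- w) / \<phi> w\<close> up to sign. What remains comes
  from differentiating the two quotients by \<open>\<phi> w\<close>.\<close>

lemma stein_sol_has_derivative: "(stein_sol s has_real_derivative stein_deriv s w) (at w)"
  unfolding stein_sol_def[abs_def]
  by (auto intro!: derivative_eq_intros H_deriv H'_minus_deriv
      simp: stein_deriv_def stein_sol_def stein_rhs_def std_normal_density_minus divide_simps)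
     (simp add: algebra_simps)

text \<open>Stein's equation is differentiated once more. Now \<open>s\<close> itself appears, and
  its continuity yields the derivative at every point, as Taylor's theorem requires.\<close>

lemma stein_deriv_has_derivative:
  "(stein_deriv s has_real_derivative s w + stein_sol s w + w * stein_deriv s w) (at w)"
proof -
  have "(stein_rhs s has_real_derivative s w) (at w)"
    unfolding stein_rhs_def[abs_def]
    by (auto intro!: derivative_eq_intros H_deriv H'_minus_deriv simp: std_normal_cdf_minus algebra_simps)
  thus ?thesis
    unfolding stein_deriv_def[abs_def]
    by (auto intro!: derivative_eq_intros stein_sol_has_derivative simp: stein_deriv_def)
qed

text \<open>Once the bounds on \<open>H\<close> and \<open>H'\<close> are inserted, the terms with a
  factor \<open>w\<close> cancel and \<open>\<Phi> w + \<Phi> (- w) = 1\<close> is left. The bound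
  serves integrability; its constant does not enter the final estimate.\<close>

lemma abs_stein_sol_le: "\<bar>stein_sol s w\<bar> \<le> 1"
proof -
  have "\<bar>stein_sol s w\<bar> \<le> \<Phi> (- w) / \<phi> w * \<bar>H w\<bar> + \<Phi> w / \<phi> w * \<bar>H' (- w)\<bar>"
    unfolding stein_sol_def
    by (rule order_trans[OF abs_triangle_ineq4]) (simp add: abs_mult std_normal_cdf_nonneg)
  also have "\<dots> \<le> \<Phi> (- w) / \<phi> w * (w * \<Phi> w + \<phi> w) + \<Phi> w / \<phi> w * (\<phi> w - w * \<Phi> (- w))"
    by (intro add_mono mult_left_mono H_bound H'_bound) (auto simp: std_normal_cdf_nonneg)
  also have "\<dots> = 1"
    by (simp add: std_normal_cdf_minus field_simps)
  finally show ?thesis .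
qed

text \<open>The bound on each of \<open>H\<close> and \<open>H'\<close> is the numerator of the
  coefficient of the other, so both terms contribute the same product of integrated tails. That
  product is at most \<open>\<phi> 0 * \<phi> w\<close>, and \<open>2 * \<phi> 0\<close> is the
  constant claimed.\<close>

lemma abs_stein_deriv_le: "\<bar>stein_deriv s w\<bar> \<le> sqrt (2 / pi)"
proof -
  have p: "\<phi> w > 0" by simp
  have eq: "stein_deriv s w = (\<phi> w - w * \<Phi> (- w)) / \<phi> w * H w - (w * \<Phi> w + \<phi> w) / \<phi> w * H' (- w)"
    unfolding stein_deriv_def stein_rhs_def stein_sol_def by (simp add: field_simps)
  have "\<bar>stein_deriv s w\<bar> \<le> (\<phi> w - w * \<Phi> (- w)) / \<phi> w * \<bar>H w\<bar> + (w * \<Phi> w + \<phi> w) / \<phi> w * \<bar>H' (- w)\<bar>"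
    unfolding eq using Mills_ratio_upper[of w] std_normal_cdf_integral_nonneg[of w]
    by (intro order_trans[OF abs_triangle_ineq4]) (simp add: abs_mult)
  also have "\<dots> \<le> (\<phi> w - w * \<Phi> (- w)) / \<phi> w * (w * \<Phi> w + \<phi> w)
      + (w * \<Phi> w + \<phi> w) / \<phi> w * (\<phi> w - w * \<Phi> (- w))"
    using Mills_ratio_upper[of w] std_normal_cdf_integral_nonneg[of w]
    by (intro add_mono mult_left_mono H_bound H'_bound) auto
  also have "\<dots> = 2 * ((w * \<Phi> w + \<phi> w) * (\<phi> w - w * \<Phi> (- w))) / \<phi> w"
    by simp
  also have "\<dots> \<le> 2 * (\<phi> 0 * \<phi> w) / \<phi> w"
    using p by (intro divide_right_mono mult_left_mono std_normal_cdf_integral_product_le) auto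
  also have "\<dots> = 2 * \<phi> 0" using p by simp
  also have "\<dots> = sqrt (2 / pi)"
    by (simp add: std_normal_density_0 real_sqrt_divide real_sqrt_mult field_simps)
  finally show ?thesis .
qed

text \<open>Both coefficients are nonnegative by \<open>Mills_ratio_lower\<close>. With the bounds
  on \<open>H\<close> and \<open>H'\<close> inserted, the weighted sum collapses to 1, and
  \<open>s\<close> adds at most 1 more.\<close>

lemma abs_stein_deriv2_le: "\<bar>s w + stein_sol s w + w * stein_deriv s w\<bar> \<le> 2"
proof -
  have p: "\<phi> w > 0" by simp
  let ?a = "((1 + w\<^sup>2) * \<Phi> (- w) - w * \<phi> w) / \<phi> w"
  let ?b = "((1 + w\<^sup>2) * \<Phi> w + w * \<phi> w) / \<phi> w"
  have a: "?a \<ge> 0" using Mills_ratio_lower[of w] by simp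
  have b: "?b \<ge> 0" using Mills_ratio_lower[of "- w"] by (simp add: std_normal_density_minus)
  have eq: "stein_sol s w + w * stein_deriv s w = - (?a * H w) - ?b * H' (- w)"
    unfolding stein_deriv_def stein_rhs_def stein_sol_def by (simp add: field_simps power2_eq_square)
  have "\<bar>- (?a * H w) - ?b * H' (- w)\<bar> \<le> ?a * \<bar>H w\<bar> + ?b * \<bar>H' (- w)\<bar>"
    by (rule order_trans[OF abs_triangle_ineq4])
       (use a b in \<open>simp only: abs_minus_cancel abs_mult abs_of_nonneg order_refl\<close>)
  also have "\<dots> \<le> ?a * (w * \<Phi> w + \<phi> w) + ?b * (\<phi> w - w * \<Phi> (- w))"
    by (intro add_mono mult_left_mono H_bound H'_bound a b)
  also have "\<dots> = 1"
    using p by (simp add: std_normal_cdf_minus field_simps power2_eq_square)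
  finally show ?thesis
    unfolding add.assoc eq using s_le_1[of w] by linarith
qed

end

section \<open>The Wasserstein distance to the normal law\<close>

text \<open>The intermediate bound \<open>w * (2 * \<Phi> w - 1) + 2 * \<phi> w\<close> is the mean
  distance of a standard normal variable from \<open>w\<close>. Linear growth is what a law with a
  first moment can integrate.\<close>

lemma abs_stein_rhs_le:
  assumes [measurable]: "s \<in> borel_measurable borel" and s_le_1: "\<And>t. \<bar>s t\<bar> \<le> 1"
  shows "\<bar>stein_rhs s w\<bar> \<le> \<bar>w\<bar> + 2"
proof -
  have "\<bar>stein_rhs s w\<bar> \<le> (w * \<Phi> w + \<phi> w) + (- w * \<Phi> (- w) + \<phi> (- w))"
    unfolding stein_rhs_def using s_le_1
    by (intro order_trans[OF abs_triangle_ineq4] add_mono abs_std_normal_cdf_integral_le) auto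
  also have "\<dots> = w * (2 * \<Phi> w - 1) + 2 * \<phi> w"
    by (simp add: std_normal_density_minus std_normal_cdf_minus algebra_simps)
  also have "w * (2 * \<Phi> w - 1) \<le> \<bar>w\<bar> * \<bar>2 * \<Phi> w - 1\<bar>"
    by (simp flip: abs_mult)
  also have "\<dots> \<le> \<bar>w\<bar> * 1"
    using std_normal_cdf_nonneg[of w] std_normal_cdf_le_1[of w]
    by (intro mult_left_mono) auto
  also have "\<phi> w \<le> 1"
  proof -
    have "1 \<le> sqrt (2 * pi)"
      using pi_gt3 by simp
    hence "\<phi> 0 \<le> 1" by (simp add: std_normal_density_0)
    moreover have "\<phi> 0 * exp (- w\<^sup>2 / 2) \<le> \<phi> 0 * 1"
      by (intro mult_left_mono) auto
    ultimately show ?thesis by (subst std_normal_density_eq) linarith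
  qed
  finally show ?thesis by simp
qed

text \<open>The function \<open>if x \<le> t then 1 else 0\<close> of \<open>t\<close> is the
  distribution function of the point mass at \<open>x\<close>; averaging over \<open>x\<close> will
  turn it into that of a general law.\<close>

lemma has_integral_stein_rhs:
  assumes [measurable]: "s \<in> borel_measurable borel" and s_le_1: "\<And>t. \<bar>s t\<bar> \<le> 1"
  shows "has_bochner_integral lborel (\<lambda>t. s t * (\<Phi> t - (if x \<le> t then 1 else 0))) (stein_rhs s x)"
proof -
  let ?G = "\<lambda>u. indicator {..- x} u *\<^sub>R (s (- u) * \<Phi> u)"
  have G: "integrable lborel ?G"
    using std_normal_cdf_set_integrable[of "\<lambda>t. s (- t)" "- x"] s_le_1
    by (simp add: set_integrable_def)
  have H: "integrable lborel (\<lambda>t. indicator {..x} t *\<^sub>R (s t * \<Phi> t))"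
    using std_normal_cdf_set_integrable[of s x] s_le_1 by (simp add: set_integrable_def)
  have "has_bochner_integral lborel (\<lambda>t. ?G (0 + (- 1) * t)) (std_normal_cdf_integral (\<lambda>t. s (- t)) (- x))"
    using lborel_integrable_real_affine[OF G, of "-1" 0] lborel_integral_real_affine[of "-1" ?G 0]
    by (auto simp: has_bochner_integral_iff std_normal_cdf_integral_def set_lebesgue_integral_def)
  moreover have "has_bochner_integral lborel (\<lambda>t. indicator {..x} t *\<^sub>R (s t * \<Phi> t)) (std_normal_cdf_integral s x)"
    using H by (simp add: has_bochner_integral_iff std_normal_cdf_integral_def set_lebesgue_integral_def)
  ultimately have *: "has_bochner_integral lborel
      (\<lambda>t. indicator {..x} t *\<^sub>R (s t * \<Phi> t) - ?G (0 + (- 1) * t)) (stein_rhs s x)"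
    unfolding stein_rhs_def by (rule has_bochner_integral_diff[rotated])
  \<comment> \<open>Both half-lines are closed and overlap at \<open>t = x\<close>, so the
    integrands agree only off this null set.\<close>
  have "AE t in lborel. indicator {..x} t *\<^sub>R (s t * \<Phi> t) - ?G (0 + (- 1) * t)
      = s t * (\<Phi> t - (if x \<le> t then 1 else 0))"
    using AE_lborel_singleton[of x]
    by eventually_elim (auto simp: indicator_def std_normal_cdf_minus algebra_simps)
  thus ?thesis
    using * by (subst (asm) has_bochner_integral_cong_AE) auto
qed

lemma stein_rhs_expectation:
  assumes "real_distribution \<mu>" and int: "integrable \<mu> (\<lambda>x. x)"
    and [measurable]: "s \<in> borel_measurable borel" and s: "\<And>t. \<bar>s t\<bar> \<le> 1"
  shows "integrable lborel (\<lambda>t. s t * (\<Phi> t - cdf \<mu> t))"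
    and "(\<integral>x. stein_rhs s x \<partial>\<mu>) = (\<integral>t. s t * (\<Phi> t - cdf \<mu> t) \<partial>lborel)"
proof -
  interpret \<mu>: real_distribution \<mu> by fact
  interpret pair_sigma_finite \<mu> lborel ..
  let ?f = "\<lambda>x t. s t * (\<Phi> t - (if x \<le> t then 1 else 0))"
  have [measurable_cong]: "sets \<mu> = sets borel" by simp
  \<comment> \<open>The absolute value of the integrand has the same form, with \<open>s\<close>
    replaced by its absolute value with a sign that flips at \<open>x\<close>. Thus the linear bound
    also controls the norm needed for Fubini's theorem.\<close>
  have norm: "(\<integral>t. norm (?f x t) \<partial>lborel) = stein_rhs (\<lambda>t. \<bar>s t\<bar> * (if x \<le> t then -1 else 1)) x" for x
  proof -
    have eq: "norm (?f x t) = \<bar>s t\<bar> * (if x \<le> t then -1 else 1) * (\<Phi> t - (if x \<le> t then 1 else 0))" for t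
      using std_normal_cdf_nonneg[of t] std_normal_cdf_le_1[of t] by (simp add: abs_mult)
    show ?thesis unfolding eq
      by (rule has_bochner_integral_integral_eq[OF has_integral_stein_rhs]) (use s in \<open>auto simp: abs_mult\<close>)
  qed
  have "integrable (\<mu> \<Otimes>\<^sub>M lborel) (case_prod ?f)"
  proof (rule Fubini_integrable)
    show "integrable \<mu> (\<lambda>x. \<integral>t. norm (case_prod ?f (x, t)) \<partial>lborel)"
    proof (rule Bochner_Integration.integrable_bound)
      show "integrable \<mu> (\<lambda>x. \<bar>x\<bar> + 2)" using int by simp
      show "AE x in \<mu>. norm (\<integral>t. norm (case_prod ?f (x, t)) \<partial>lborel) \<le> norm (\<bar>x\<bar> + 2)"
      proof (intro always_eventually allI)
        fix x
        show "norm (\<integral>t. norm (case_prod ?f (x, t)) \<partial>lborel) \<le> norm (\<bar>x\<bar> + 2)"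
          using abs_stein_rhs_le[of "\<lambda>t. \<bar>s t\<bar> * (if x \<le> t then -1 else 1)" x] s norm[of x] by (simp add: abs_mult)
      qed
    qed measurable
    show "AE x in \<mu>. integrable lborel (\<lambda>t. case_prod ?f (x, t))"
      using integrable.intros[OF has_integral_stein_rhs[of s]] s by simp
  qed measurable
  note int2 = this
  have eq: "(\<integral>x. ?f x t \<partial>\<mu>) = s t * (\<Phi> t - cdf \<mu> t)" for t
  proof -
    have "(\<integral>x. (if x \<le> t then 1 else 0) \<partial>\<mu>) = (\<integral>x. indicator {..t} x \<partial>\<mu>)"
      by (intro Bochner_Integration.integral_cong) (auto simp: indicator_def)
    also have "\<dots> = cdf \<mu> t" by (simp add: cdf_def)
    finally have *: "(\<integral>x. (if x \<le> t then 1 else 0) \<partial>\<mu>) = cdf \<mu> t" .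
    have "integrable \<mu> (\<lambda>x. if x \<le> t then 1 else 0 :: real)"
      by (rule \<mu>.integrable_const_bound[where B = 1]) auto
    thus ?thesis using * \<mu>.prob_space by simp
  qed
  show "integrable lborel (\<lambda>t. s t * (\<Phi> t - cdf \<mu> t))"
    using integrable_snd[OF int2] unfolding split_conv eq .
  have "(\<integral>x. stein_rhs s x \<partial>\<mu>) = (\<integral>x. \<integral>t. ?f x t \<partial>lborel \<partial>\<mu>)"
    using has_bochner_integral_integral_eq[OF has_integral_stein_rhs[of s]] s by simp
  also have "\<dots> = (\<integral>t. \<integral>x. ?f x t \<partial>\<mu> \<partial>lborel)"
    using Fubini_integral[OF int2] by simp
  finally show "(\<integral>x. stein_rhs s x \<partial>\<mu>) = (\<integral>t. s t * (\<Phi> t - cdf \<mu> t) \<partial>lborel)"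
    unfolding eq .
qed

text \<open>The choice \<open>s = sgn D\<close> would give the claim at once but need not be
  continuous. It is an almost everywhere limit of continuous functions, and dominated convergence
  carries the bound over.\<close>

lemma integral_abs_le_of_continuous:
  fixes D :: "real \<Rightarrow> real"
  assumes D: "integrable lborel D"
    and le: "\<And>s. continuous_on UNIV s \<Longrightarrow> (\<And>t. \<bar>s t\<bar> \<le> 1) \<Longrightarrow> (\<integral>t. s t * D t \<partial>lborel) \<le> B"
  shows "(\<integral>t. \<bar>D t\<bar> \<partial>lborel) \<le> B"
proof -
  have [measurable]: "D \<in> borel_measurable borel" using borel_measurable_integrable[OF D] by simp
  have "(\<lambda>t. sgn (D t)) \<in> borel_measurable lborel" by measurable
  hence "(\<lambda>t. sgn (D t)) \<in> borel_measurable lebesgue" by (rule measurable_completion)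
  hence "(\<lambda>t. sgn (D t)) measurable_on UNIV"
    by (rule lebesgue_measurable_imp_measurable_on) auto
  then obtain N g where N: "negligible N" and g: "\<And>n. continuous_on UNIV (g n)"
    and lim: "\<And>t. t \<notin> N \<Longrightarrow> (\<lambda>n. g n t) \<longlonglongrightarrow> sgn (D t)"
    unfolding measurable_on_def by auto
  \<comment> \<open>Clamping makes the approximants admissible and leaves the limit unchanged, since
    \<open>sgn\<close> takes values in \<open>[-1, 1]\<close>.\<close>
  define h where "h n t = max (- 1) (min 1 (g n t))" for n t
  have h_cont: "continuous_on UNIV (h n)" for n
    unfolding h_def by (intro continuous_intros g)
  have [measurable]: "h n \<in> borel_measurable borel" for n
    by (intro borel_measurable_continuous_onI h_cont)
  have h_le: "\<bar>h n t\<bar> \<le> 1" for n t by (auto simp: h_def)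
  have h_lim: "(\<lambda>n. h n t) \<longlonglongrightarrow> sgn (D t)" if "t \<notin> N" for t
  proof -
    have "(\<lambda>n. h n t) \<longlonglongrightarrow> max (- 1) (min 1 (sgn (D t)))"
      unfolding h_def by (intro tendsto_intros lim that)
    thus ?thesis by (simp add: sgn_if split: if_splits)
  qed
  have "AE t in lebesgue. t \<notin> N"
    using N by (intro AE_not_in) (simp add: negligible_iff_null_sets)
  hence AE: "AE t in lborel. t \<notin> N"
    by (simp add: AE_completion_iff)
  have "(\<lambda>n. \<integral>t. h n t * D t \<partial>lborel) \<longlonglongrightarrow> (\<integral>t. sgn (D t) * D t \<partial>lborel)"
  proof (rule integral_dominated_convergence[where w = "\<lambda>t. \<bar>D t\<bar>"])
    show "AE t in lborel. (\<lambda>n. h n t * D t) \<longlonglongrightarrow> sgn (D t) * D t"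
      using AE by eventually_elim (intro tendsto_intros h_lim)
    show "AE t in lborel. norm (h n t * D t) \<le> \<bar>D t\<bar>" for n
      using h_le by (intro always_eventually) (simp add: abs_mult mult_left_le_one_le)
  qed (use D in auto)
  hence "(\<integral>t. sgn (D t) * D t \<partial>lborel) \<le> B"
    by (rule LIMSEQ_le_const2) (use le[OF h_cont h_le] in auto)
  thus ?thesis by (simp add: abs_sgn mult.commute)
qed

text \<open>A one-sided bound over all \<open>s\<close> suffices, because the sign of
  \<open>s\<close> can follow that of \<open>\<Phi> t - cdf \<mu> t\<close>. Stein's equation
  rewrites each such integral as an expectation under \<open>\<mu>\<close>.\<close>

lemma wasserstein_dist_std_normal_le:
  assumes "real_distribution \<mu>" and int: "integrable \<mu> (\<lambda>x. x)"
    and le: "\<And>s. continuous_on UNIV s \<Longrightarrow> (\<And>t. \<bar>s t\<bar> \<le> 1) \<Longrightarrow>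
               (\<integral>x. stein_deriv s x - x * stein_sol s x \<partial>\<mu>) \<le> B"
  shows "wasserstein_dist \<mu> std_normal_distribution \<le> ennreal B"
proof -
  note rhs = stein_rhs_expectation[OF assms(1) int]
  have int_diff: "integrable lborel (\<lambda>t. \<Phi> t - cdf \<mu> t)"
    using rhs(1)[of "\<lambda>_. 1"] by simp
  have "(\<integral>t. \<bar>\<Phi> t - cdf \<mu> t\<bar> \<partial>lborel) \<le> B"
  proof (rule integral_abs_le_of_continuous[OF int_diff])
    fix s :: "real \<Rightarrow> real" assume s: "continuous_on UNIV s" "\<And>t. \<bar>s t\<bar> \<le> 1"
    have "(\<integral>t. s t * (\<Phi> t - cdf \<mu> t) \<partial>lborel) = (\<integral>x. stein_rhs s x \<partial>\<mu>)"
      using s by (intro rhs(2)[symmetric] borel_measurable_continuous_onI) auto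
    also have "\<dots> = (\<integral>x. stein_deriv s x - x * stein_sol s x \<partial>\<mu>)"
      by (simp add: stein_deriv_def)
    also have "\<dots> \<le> B" by (rule le[OF s])
    finally show "(\<integral>t. s t * (\<Phi> t - cdf \<mu> t) \<partial>lborel) \<le> B" .
  qed
  moreover have "wasserstein_dist \<mu> std_normal_distribution = ennreal (\<integral>t. \<bar>\<Phi> t - cdf \<mu> t\<bar> \<partial>lborel)"
    unfolding wasserstein_dist_def
    by (subst nn_integral_eq_integral[symmetric]) (use integrable_abs[OF int_diff] in \<open>auto simp: abs_minus_commute[of "\<Phi> _"]\<close>)
  ultimately show ?thesis by (simp add: ennreal_leI)
qed

section \<open>Random indices\<close>

text \<open>The events determined by \<open>f (X \<omega>)\<close> are among those determined by
  \<open>X\<close>, and likewise for \<open>Y\<close>; the passage to Borel functions of a common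
  kind makes the product rule for expectations available.\<close>

lemma (in prob_space) indep_elements_imp_indep_var:
  assumes "indep_elements M S X T Y"
    and f: "f \<in> borel_measurable S" and g: "g \<in> borel_measurable T"
  shows "indep_var borel (\<lambda>\<omega>. f (X \<omega>)) borel (\<lambda>\<omega>. g (Y \<omega>))"
proof -
  have X [measurable]: "X \<in> measurable M S" and Y [measurable]: "Y \<in> measurable M T"
    and ind: "indep_set {X -` A \<inter> space M | A. A \<in> sets S} {Y -` B \<inter> space M | B. B \<in> sets T}"
    using assms(1) by (auto simp: indep_elements_def)
  have sub: "sigma_sets (space M) {(\<lambda>\<omega>. h (Z \<omega>)) -` A \<inter> space M | A. A \<in> sets borel}
      \<subseteq> {Z -` A \<inter> space M | A. A \<in> sets U}"
    if Z: "Z \<in> measurable M U" and h: "h \<in> borel_measurable U" for Z U and h :: "_ \<Rightarrow> 'd :: topological_space"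
  proof -
    let ?V = "vimage_algebra (space M) Z U"
    have sets_V: "sets ?V = {Z -` A \<inter> space M | A. A \<in> sets U}"
      using measurable_space[OF Z] by (intro sets_vimage_algebra2) auto
    have "{(\<lambda>\<omega>. h (Z \<omega>)) -` A \<inter> space M | A. A \<in> sets borel} \<subseteq> sets ?V"
    proof safe
      fix A :: "'d set" assume A: "A \<in> sets borel"
      have "(\<lambda>\<omega>. h (Z \<omega>)) -` A \<inter> space M = Z -` (h -` A \<inter> space U) \<inter> space M"
        using measurable_space[OF Z] by auto
      thus "(\<lambda>\<omega>. h (Z \<omega>)) -` A \<inter> space M \<in> sets ?V"
        unfolding sets_V using measurable_sets[OF h A] by blast
    qed
    from sets.sigma_sets_subset[OF this] show ?thesis
      by (simp add: sets_V)
  qed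
  show ?thesis
    unfolding indep_var_eq
  proof (intro conjI)
    show "indep_set (sigma_sets (space M) {(\<lambda>\<omega>. f (X \<omega>)) -` A \<inter> space M | A. A \<in> sets borel})
        (sigma_sets (space M) {(\<lambda>\<omega>. g (Y \<omega>)) -` A \<inter> space M | A. A \<in> sets borel})"
      using ind unfolding indep_set_def
      by (rule indep_sets_mono_sets) (use sub[OF X f] sub[OF Y g] in \<open>auto split: bool.split\<close>)
  qed (use f g in measurable)
qed

lemma (in prob_space) abs_expectation_le:
  fixes f g :: "'a \<Rightarrow> real"
  assumes "integrable M g" "\<And>\<omega>. \<omega> \<in> space M \<Longrightarrow> \<bar>f \<omega>\<bar> \<le> g \<omega>"
  shows "\<bar>expectation f\<bar> \<le> expectation g"
proof -
  have "\<bar>expectation f\<bar> \<le> expectation (\<lambda>\<omega>. \<bar>f \<omega>\<bar>)" by (rule integral_abs_bound)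
  also have "\<dots> \<le> expectation g"
    by (rule integral_mono') (use assms in \<open>auto intro: order_trans[OF abs_ge_zero]\<close>)
  finally show ?thesis .
qed

lemma (in prob_space) abs_expectation_le_prob:
  fixes f :: "'a \<Rightarrow> real"
  assumes [measurable]: "A \<in> events" and le: "\<And>\<omega>. \<omega> \<in> space M \<Longrightarrow> \<bar>f \<omega>\<bar> \<le> C * indicator A \<omega>"
  shows "\<bar>expectation f\<bar> \<le> C * prob A"
proof -
  have "integrable M (\<lambda>\<omega>. C * indicator A \<omega>)"
    by (intro integrable_mult_right integrable_real_indicator) (auto simp: less_top[symmetric])
  from abs_expectation_le[OF this, of f] le show ?thesis by simp
qed

lemma measurable_compose_count_space:
  "N \<in> measurable M (count_space UNIV) \<Longrightarrow> (\<lambda>\<omega>. (f (N \<omega>) :: 'b :: topological_space)) \<in> borel_measurable M"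
  by (rule measurable_compose[where N = "count_space UNIV"]) auto

text \<open>For every outcome only the term \<open>n = N \<omega>\<close> of the series is nonzero,
  so integral and sum may be exchanged. The hypothesis is the product rule itself, which is
  immediate for constant \<open>G n\<close>.\<close>

lemma (in prob_space) nn_integral_random_index:
  fixes N :: "'a \<Rightarrow> nat" and G :: "nat \<Rightarrow> 'a \<Rightarrow> real"
  assumes N [measurable]: "N \<in> measurable M (count_space UNIV)"
    and int: "\<And>n. integrable M (G n)"
    and nonneg: "\<And>n \<omega>. G n \<omega> \<ge> 0"
    and factor: "\<And>n. expectation (\<lambda>\<omega>. indicator {n} (N \<omega>) * G n \<omega>) = expectation (\<lambda>\<omega>. indicator {n} (N \<omega>)) * expectation (G n)"
  shows "(\<integral>\<^sup>+\<omega>. ennreal (G (N \<omega>) \<omega>) \<partial>M) = (\<Sum>n. ennreal (expectation (\<lambda>\<omega>. indicator {n} (N \<omega>)) * expectation (G n)))"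
proof -
  have [measurable]: "G n \<in> borel_measurable M" for n using int[of n] by simp
  have [measurable]: "(\<lambda>\<omega>. indicator {n} (N \<omega>) :: real) \<in> borel_measurable M" for n
    using N by (rule measurable_compose_count_space)
  have single: "(\<Sum>n. ennreal (indicator {n} (N \<omega>) * G n \<omega>)) = ennreal (G (N \<omega>) \<omega>)" for \<omega>
    by (subst suminf_finite[of "{N \<omega>}"]) auto
  have "integrable M (\<lambda>\<omega>. indicator {n} (N \<omega>) * G n \<omega>)" for n
    by (rule Bochner_Integration.integrable_bound[OF int[of n]]) (auto simp: indicator_def)
  hence "(\<integral>\<^sup>+\<omega>. ennreal (indicator {n} (N \<omega>) * G n \<omega>) \<partial>M)
      = ennreal (expectation (\<lambda>\<omega>. indicator {n} (N \<omega>)) * expectation (G n))" for n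
    unfolding factor[symmetric] by (intro nn_integral_eq_integral) (auto simp: nonneg)
  moreover have "(\<integral>\<^sup>+\<omega>. ennreal (G (N \<omega>) \<omega>) \<partial>M) = (\<Sum>n. \<integral>\<^sup>+\<omega>. ennreal (indicator {n} (N \<omega>) * G n \<omega>) \<partial>M)"
    unfolding single[symmetric] by (rule nn_integral_suminf) measurable
  ultimately show ?thesis by simp
qed

lemma (in prob_space) nn_integral_random_index_expectation:
  fixes N :: "'a \<Rightarrow> nat" and G :: "nat \<Rightarrow> 'a \<Rightarrow> real"
  assumes N [measurable]: "N \<in> measurable M (count_space UNIV)"
    and indep: "\<And>n. indep_var borel (\<lambda>\<omega>. indicator {n} (N \<omega>) :: real) borel (G n)"
    and int: "\<And>n. integrable M (G n)"
    and nonneg: "\<And>n \<omega>. G n \<omega> \<ge> 0"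
  shows "(\<integral>\<^sup>+\<omega>. ennreal (G (N \<omega>) \<omega>) \<partial>M) = (\<integral>\<^sup>+\<omega>. ennreal (expectation (G (N \<omega>))) \<partial>M)"
proof -
  have "integrable M (\<lambda>\<omega>. indicator {n} (N \<omega>) :: real)" for n
    by (rule integrable_const_bound[where B = 1])
       (auto simp: indicator_def intro: measurable_compose_count_space[OF N])
  note factor = indep_var_lebesgue_integral[OF indep this int]
  have "(\<integral>\<^sup>+\<omega>. ennreal (G (N \<omega>) \<omega>) \<partial>M) = (\<Sum>n. ennreal (expectation (\<lambda>\<omega>. indicator {n} (N \<omega>)) * expectation (G n)))"
    by (rule nn_integral_random_index[OF N int nonneg factor])
  \<comment> \<open>The inner expectations are regarded as constant random variables, so that the
    series formula, read backwards, applies to them.\<close>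
  also have "\<dots> = (\<Sum>n. ennreal (expectation (\<lambda>\<omega>. indicator {n} (N \<omega>)) * expectation (\<lambda>\<omega>. expectation (G n))))"
    by (simp add: prob_space)
  also have "\<dots> = (\<integral>\<^sup>+\<omega>. ennreal (expectation (G (N \<omega>))) \<partial>M)"
    by (rule nn_integral_random_index[OF N, symmetric])
       (use nonneg prob_space in \<open>auto intro: integral_nonneg\<close>)
  finally show ?thesis .
qed

text \<open>The nonnegative identity is applied to the positive and negative parts; integrability of
  the composed variable makes both finite, so they can be subtracted.\<close>

lemma (in prob_space)
  fixes N :: "'a \<Rightarrow> nat"
  assumes N [measurable]: "N \<in> measurable M (count_space UNIV)"
    and indep: "\<And>n. indep_var borel (\<lambda>\<omega>. indicator {n} (N \<omega>) :: real) borel (G n)"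
    and int: "\<And>n. integrable M (G n)"
    and intN: "integrable M (\<lambda>\<omega>. G (N \<omega>) \<omega>)"
  shows integrable_random_index: "integrable M (\<lambda>\<omega>. expectation (G (N \<omega>)) :: real)"
    and expectation_random_index: "expectation (\<lambda>\<omega>. G (N \<omega>) \<omega>) = expectation (\<lambda>\<omega>. expectation (G (N \<omega>)))"
proof -
  have part: "has_bochner_integral M (\<lambda>\<omega>. expectation (\<lambda>\<omega>'. g (G (N \<omega>) \<omega>'))) (expectation (\<lambda>\<omega>. g (G (N \<omega>) \<omega>)))"
    if g [measurable]: "g \<in> borel_measurable borel" and g_nonneg: "\<And>x. g x \<ge> 0"
      and g_int: "\<And>f. integrable M f \<Longrightarrow> integrable M (\<lambda>\<omega>. g (f \<omega>))" for g :: "real \<Rightarrow> real"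
  proof -
    have "indep_var borel (\<lambda>\<omega>. indicator {n} (N \<omega>) :: real) borel (\<lambda>\<omega>. g (G n \<omega>))" for n
      using indep_var_compose[OF indep measurable_ident g, of n] by (simp add: comp_def)
    from nn_integral_random_index_expectation[OF N this]
    have "(\<integral>\<^sup>+\<omega>. ennreal (expectation (\<lambda>\<omega>'. g (G (N \<omega>) \<omega>'))) \<partial>M) = (\<integral>\<^sup>+\<omega>. ennreal (g (G (N \<omega>) \<omega>)) \<partial>M)"
      using g_int int g_nonneg by simp
    also have "\<dots> = ennreal (expectation (\<lambda>\<omega>. g (G (N \<omega>) \<omega>)))"
      using g_int[OF intN] g_nonneg by (intro nn_integral_eq_integral) auto
    finally show ?thesis
      using g_nonneg by (intro has_bochner_integral_nn_integral measurable_compose_count_space[OF N]) auto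
  qed
  have "has_bochner_integral M
      (\<lambda>\<omega>. expectation (\<lambda>\<omega>'. max 0 (G (N \<omega>) \<omega>')) - expectation (\<lambda>\<omega>'. max 0 (- G (N \<omega>) \<omega>')))
      (expectation (\<lambda>\<omega>. max 0 (G (N \<omega>) \<omega>)) - expectation (\<lambda>\<omega>. max 0 (- G (N \<omega>) \<omega>)))"
    by (intro has_bochner_integral_diff part) (auto intro!: integrable_max)
  moreover have split: "expectation (\<lambda>\<omega>. max 0 (f \<omega>)) - expectation (\<lambda>\<omega>. max 0 (- f \<omega>)) = expectation f"
    if "integrable M f" for f :: "'a \<Rightarrow> real"
  proof -
    have "expectation (\<lambda>\<omega>. max 0 (f \<omega>)) - expectation (\<lambda>\<omega>. max 0 (- f \<omega>))
        = expectation (\<lambda>\<omega>. max 0 (f \<omega>) - max 0 (- f \<omega>))"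
      by (intro Bochner_Integration.integral_diff[symmetric] integrable_max integrable_minus that) auto
    also have "(\<lambda>\<omega>. max 0 (f \<omega>) - max 0 (- f \<omega>)) = f"
      by (auto simp: fun_eq_iff max_def)
    finally show ?thesis .
  qed
  ultimately have "has_bochner_integral M (\<lambda>\<omega>. expectation (G (N \<omega>))) (expectation (\<lambda>\<omega>. G (N \<omega>) \<omega>))"
    using int intN by simp
  thus "integrable M (\<lambda>\<omega>. expectation (G (N \<omega>)))"
    "expectation (\<lambda>\<omega>. G (N \<omega>) \<omega>) = expectation (\<lambda>\<omega>. expectation (G (N \<omega>)))"
    by (auto simp: has_bochner_integral_iff)
qed

section \<open>Random sums\<close>

lemma abs_diff_le_of_deriv_bound:
  fixes f :: "real \<Rightarrow> real"
  assumes "\<And>x. (f has_real_derivative f' x) (at x)" "\<And>x. \<bar>f' x\<bar> \<le> B"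
  shows "\<bar>f x - f y\<bar> \<le> B * \<bar>x - y\<bar>"
  using field_differentiable_bound[of UNIV f f' B x y] assms by (simp add: has_field_derivative_at_within)

lemma abs_second_order_remainder_le:
  fixes f :: "real \<Rightarrow> real"
  assumes f: "\<And>x. (f has_real_derivative f' x) (at x)" and f': "\<And>x. (f' has_real_derivative f'' x) (at x)"
    and le: "\<And>x. \<bar>f'' x\<bar> \<le> K"
  shows "\<bar>f (x + y) - f y - x * f' y\<bar> \<le> K / 2 * x\<^sup>2"
proof (cases "x = 0")
  case False
  define d where "d = (\<lambda>m :: nat. if m = 0 then f else if m = 1 then f' else f'')"
  have "\<exists>t. (if x + y < y then x + y < t \<and> t < y else y < t \<and> t < x + y) \<and>
      f (x + y) = (\<Sum>m<2. (d m y / fact m) * (x + y - y) ^ m) + (d 2 t / fact 2) * (x + y - y) ^ 2"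
    by (rule Taylor[where a = "min y (x + y)" and b = "max y (x + y)"])
       (use False f f' in \<open>auto simp: d_def less_2_cases_iff\<close>)
  then obtain t where "f (x + y) = f y + f' y * x + f'' t / 2 * x\<^sup>2"
    by (auto simp: d_def numeral_2_eq_2)
  hence "\<bar>f (x + y) - f y - x * f' y\<bar> = \<bar>f'' t\<bar> / 2 * x\<^sup>2"
    by (simp add: abs_mult algebra_simps)
  also have "\<dots> \<le> K / 2 * x\<^sup>2"
    using le[of t] by (intro mult_right_mono divide_right_mono) auto
  finally show ?thesis .
qed auto

section \<open>One centred summand and an independent remainder\<close>

context prob_space
begin

context
  fixes X R :: "'a \<Rightarrow> real" and k k' k'' :: "real \<Rightarrow> real" and C L K :: real
  assumes indep: "indep_var borel X borel R"
    and X_square: "integrable M (\<lambda>\<omega>. (X \<omega>)\<^sup>2)" and X_mean: "expectation X = 0"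
    and k: "\<And>x. (k has_real_derivative k' x) (at x)" and k': "\<And>x. (k' has_real_derivative k'' x) (at x)"
    and k_le: "\<And>x. \<bar>k x\<bar> \<le> C" and k'_le: "\<And>x. \<bar>k' x\<bar> \<le> L" and k''_le: "\<And>x. \<bar>k'' x\<bar> \<le> K"
begin

private lemma X_R_measurable: "X \<in> borel_measurable M" "R \<in> borel_measurable M"
  using indep_var_rv1[OF indep] indep_var_rv2[OF indep] by auto

private lemma k_measurable: "k \<in> borel_measurable borel" "k' \<in> borel_measurable borel"
  by (intro borel_measurable_continuous_onI continuous_at_imp_continuous_on ballI DERIV_isCont[OF k]
        DERIV_isCont[OF k'])+

private lemma X_integrable: "integrable M X"
  using square_integrable_imp_integrable[OF X_R_measurable(1) X_square] .

private lemma k_R_integrable: "integrable M (\<lambda>\<omega>. k (R \<omega>))" "integrable M (\<lambda>\<omega>. k' (R \<omega>))"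
    "integrable M (\<lambda>\<omega>. k' (X \<omega> + R \<omega>))"
proof -
  note [measurable] = X_R_measurable k_measurable
  show "integrable M (\<lambda>\<omega>. k (R \<omega>))"
    by (rule integrable_const_bound[where B = C]) (use k_le in auto)
  show "integrable M (\<lambda>\<omega>. k' (R \<omega>))" "integrable M (\<lambda>\<omega>. k' (X \<omega> + R \<omega>))"
    by (rule integrable_const_bound[where B = L]; use k'_le in auto)+
qed

private lemma X_k_R:
  "integrable M (\<lambda>\<omega>. X \<omega> * k (R \<omega>))" "expectation (\<lambda>\<omega>. X \<omega> * k (R \<omega>)) = 0"
proof -
  have "indep_var borel X borel (\<lambda>\<omega>. k (R \<omega>))"
    using indep_var_compose[OF indep measurable_ident k_measurable(1)] by (simp add: comp_def)
  from indep_var_integrable[OF this] indep_var_lebesgue_integral[OF this] X_integrable k_R_integrable X_mean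
  show "integrable M (\<lambda>\<omega>. X \<omega> * k (R \<omega>))" "expectation (\<lambda>\<omega>. X \<omega> * k (R \<omega>)) = 0" by auto
qed

private lemma X_k_diff_integrable: "integrable M (\<lambda>\<omega>. X \<omega> * (k (X \<omega> + R \<omega>) - k (R \<omega>)))"
  and abs_X_k_diff_le: "\<bar>X \<omega> * (k (X \<omega> + R \<omega>) - k (R \<omega>))\<bar> \<le> L * (X \<omega>)\<^sup>2"
proof -
  show le: "\<bar>X \<omega> * (k (X \<omega> + R \<omega>) - k (R \<omega>))\<bar> \<le> L * (X \<omega>)\<^sup>2" for \<omega>
  proof -
    have "\<bar>X \<omega>\<bar> * \<bar>k (X \<omega> + R \<omega>) - k (R \<omega>)\<bar> \<le> \<bar>X \<omega>\<bar> * (L * \<bar>X \<omega>\<bar>)"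
      using abs_diff_le_of_deriv_bound[OF k k'_le, of "X \<omega> + R \<omega>" "R \<omega>"] by (intro mult_left_mono) auto
    also have "\<dots> = L * (\<bar>X \<omega>\<bar> * \<bar>X \<omega>\<bar>)" by simp
    finally show ?thesis unfolding abs_mult abs_mult_self_eq power2_eq_square .
  qed
  have [measurable]: "X \<in> borel_measurable M" "R \<in> borel_measurable M"
      "k \<in> borel_measurable borel" by (fact X_R_measurable k_measurable)+
  have "integrable M (\<lambda>\<omega>. L * (X \<omega>)\<^sup>2)" using X_square by simp
  thus "integrable M (\<lambda>\<omega>. X \<omega> * (k (X \<omega> + R \<omega>) - k (R \<omega>)))"
    by (rule Bochner_Integration.integrable_bound) (auto intro!: always_eventually order_trans[OF le abs_ge_self])
qed

text \<open>The product \<open>X * k R\<close> has mean zero, as \<open>X\<close> is centred and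
  independent of \<open>R\<close>. Subtracting it leaves an increment of \<open>k\<close>, which is
  of order \<open>\<bar>X\<bar>\<close>.\<close>

lemma expectation_centered_mult_eq:
  "expectation (\<lambda>\<omega>. X \<omega> * k (X \<omega> + R \<omega>)) = expectation (\<lambda>\<omega>. X \<omega> * (k (X \<omega> + R \<omega>) - k (R \<omega>)))"
  using Bochner_Integration.integral_add[OF X_k_diff_integrable X_k_R(1)] X_k_R(2)
  by (simp add: algebra_simps)

text \<open>The increment of \<open>k\<close> is at most \<open>L * \<bar>X\<bar>\<close>, so a
  second moment suffices. This is the crude estimate for the part of each term that is not
  expanded.\<close>

lemma abs_expectation_centered_mult_le:
  "\<bar>expectation (\<lambda>\<omega>. X \<omega> * k (X \<omega> + R \<omega>))\<bar> \<le> L * expectation (\<lambda>\<omega>. (X \<omega>)\<^sup>2)"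
  unfolding expectation_centered_mult_eq
  using abs_expectation_le[of "\<lambda>\<omega>. L * (X \<omega>)\<^sup>2" "\<lambda>\<omega>. X \<omega> * (k (X \<omega> + R \<omega>) - k (R \<omega>))"] abs_X_k_diff_le X_square
  by simp

text \<open>The product of \<open>X\<close> with the increment of \<open>k\<close> is replaced by
  \<open>X\<^sup>2 * k' R\<close>, with Taylor remainder \<open>K / 2 * \<bar>X\<bar> ^ 3\<close>.
  Independence factorises the latter's expectation, and replacing \<open>k' R\<close> by
  \<open>k' (X + R)\<close> costs \<open>K * \<bar>X\<bar>\<close>.\<close>

lemma abs_expectation_centered_mult_diff_le:
  assumes X_cube: "integrable M (\<lambda>\<omega>. \<bar>X \<omega>\<bar> ^ 3)"
  shows "\<bar>expectation (\<lambda>\<omega>. X \<omega> * k (X \<omega> + R \<omega>))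
      - expectation (\<lambda>\<omega>. (X \<omega>)\<^sup>2) * expectation (\<lambda>\<omega>. k' (X \<omega> + R \<omega>))\<bar>
    \<le> K * (expectation (\<lambda>\<omega>. \<bar>X \<omega>\<bar> ^ 3) / 2 + expectation (\<lambda>\<omega>. (X \<omega>)\<^sup>2) * expectation (\<lambda>\<omega>. \<bar>X \<omega>\<bar>))"
proof -
  let ?v = "expectation (\<lambda>\<omega>. (X \<omega>)\<^sup>2)"
  have "indep_var borel (\<lambda>\<omega>. (X \<omega>)\<^sup>2) borel (\<lambda>\<omega>. k' (R \<omega>))"
    using indep_var_compose[OF indep _ k_measurable(2), of "\<lambda>x. x\<^sup>2" borel] by (simp add: comp_def)
  note ind = indep_var_integrable[OF this X_square k_R_integrable(2)]
    indep_var_lebesgue_integral[OF this X_square k_R_integrable(2)]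
  have eq: "expectation (\<lambda>\<omega>. X \<omega> * k (X \<omega> + R \<omega>)) - ?v * expectation (\<lambda>\<omega>. k' (X \<omega> + R \<omega>))
      = expectation (\<lambda>\<omega>. X \<omega> * (k (X \<omega> + R \<omega>) - k (R \<omega>)) - (X \<omega>)\<^sup>2 * k' (R \<omega>))
        - ?v * expectation (\<lambda>\<omega>. k' (X \<omega> + R \<omega>) - k' (R \<omega>))"
    unfolding expectation_centered_mult_eq Bochner_Integration.integral_diff[OF X_k_diff_integrable ind(1)]
      Bochner_Integration.integral_diff[OF k_R_integrable(3,2)] ind(2)
    by (simp add: algebra_simps)
  have "\<bar>expectation (\<lambda>\<omega>. X \<omega> * k (X \<omega> + R \<omega>)) - ?v * expectation (\<lambda>\<omega>. k' (X \<omega> + R \<omega>))\<bar>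
      \<le> \<bar>expectation (\<lambda>\<omega>. X \<omega> * (k (X \<omega> + R \<omega>) - k (R \<omega>)) - (X \<omega>)\<^sup>2 * k' (R \<omega>))\<bar>
        + ?v * \<bar>expectation (\<lambda>\<omega>. k' (X \<omega> + R \<omega>) - k' (R \<omega>))\<bar>"
    unfolding eq by (rule order_trans[OF abs_triangle_ineq4]) (simp add: abs_mult)
  also have "\<dots> \<le> expectation (\<lambda>\<omega>. K / 2 * \<bar>X \<omega>\<bar> ^ 3) + ?v * expectation (\<lambda>\<omega>. K * \<bar>X \<omega>\<bar>)"
  proof (intro add_mono mult_left_mono abs_expectation_le)
    fix \<omega>
    have "\<bar>X \<omega> * (k (X \<omega> + R \<omega>) - k (R \<omega>)) - (X \<omega>)\<^sup>2 * k' (R \<omega>)\<bar>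
        = \<bar>X \<omega>\<bar> * \<bar>k (X \<omega> + R \<omega>) - k (R \<omega>) - X \<omega> * k' (R \<omega>)\<bar>"
      by (simp add: power2_eq_square algebra_simps flip: abs_mult)
    also have "\<dots> \<le> \<bar>X \<omega>\<bar> * (K / 2 * (X \<omega>)\<^sup>2)"
      by (intro mult_left_mono abs_second_order_remainder_le[OF k k' k''_le]) auto
    also have "\<dots> = K / 2 * \<bar>X \<omega>\<bar> ^ 3"
      by (simp add: power3_eq_cube power2_eq_square)
    finally show "\<bar>X \<omega> * (k (X \<omega> + R \<omega>) - k (R \<omega>)) - (X \<omega>)\<^sup>2 * k' (R \<omega>)\<bar> \<le> K / 2 * \<bar>X \<omega>\<bar> ^ 3" .
    show "\<bar>k' (X \<omega> + R \<omega>) - k' (R \<omega>)\<bar> \<le> K * \<bar>X \<omega>\<bar>"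
      using abs_diff_le_of_deriv_bound[OF k' k''_le, of "X \<omega> + R \<omega>" "R \<omega>"] by simp
  qed (use X_cube X_integrable in auto)
  also have "\<dots> = K * (expectation (\<lambda>\<omega>. \<bar>X \<omega>\<bar> ^ 3) / 2 + ?v * expectation (\<lambda>\<omega>. \<bar>X \<omega>\<bar>))"
    by (simp add: algebra_simps)
  finally show ?thesis .
qed

end

end

text \<open>Indices start at 0: \<open>Y i\<close> stands for \<open>X\<^sub>i\<^sub>+\<^sub>1\<close> of the theorem, hence \<open>q i = P (N \<ge> i + 1)\<close> below.\<close>

locale random_sum = prob_space +
  fixes Y :: "nat \<Rightarrow> 'a \<Rightarrow> real" and N :: "'a \<Rightarrow> nat"
  assumes Y_square: "\<And>i. integrable M (\<lambda>\<omega>. (Y i \<omega>)\<^sup>2)"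
    and Y_mean: "\<And>i. expectation (Y i) = 0"
    and Y_indep: "\<And>i J. finite J \<Longrightarrow> i \<notin> J \<Longrightarrow> indep_var borel (Y i) borel (\<lambda>\<omega>. \<Sum>j\<in>J. Y j \<omega>)"
    and N_measurable [measurable]: "N \<in> measurable M (count_space UNIV)"
    and N_indep: "\<And>n. indep_var borel (\<lambda>\<omega>. indicator {n} (N \<omega>) :: real) borel (\<lambda>\<omega>. \<Sum>j<n. Y j \<omega>)"
begin

definition S :: "nat \<Rightarrow> 'a \<Rightarrow> real" where "S n \<omega> = (\<Sum>j<n. Y j \<omega>)"

definition v :: "nat \<Rightarrow> real" where "v i = expectation (\<lambda>\<omega>. (Y i \<omega>)\<^sup>2)"

definition q :: "nat \<Rightarrow> real" where "q i = prob {\<omega> \<in> space M. i < N \<omega>}"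

lemma Y_measurable [measurable]: "Y i \<in> borel_measurable M"
  using indep_var_rv1[OF Y_indep[of "{}" i]] by simp

lemma S_measurable [measurable]: "S n \<in> borel_measurable M"
  unfolding S_def by measurable

lemma random_sum_measurable [measurable]: "(\<lambda>\<omega>. S (N \<omega>) \<omega>) \<in> borel_measurable M"
  by (rule measurable_compose_countable) measurable

lemma Y_integrable: "integrable M (Y i)"
  using square_integrable_imp_integrable[OF Y_measurable Y_square] .

lemma v_nonneg: "v i \<ge> 0" by (simp add: v_def)

lemma q_nonneg: "q i \<ge> 0" by (simp add: q_def)

lemma q_le_1: "q i \<le> 1" by (simp add: q_def)

lemma N_indep_comp:
  assumes "h \<in> borel_measurable borel"
  shows "indep_var borel (\<lambda>\<omega>. indicator {n} (N \<omega>) :: real) borel (\<lambda>\<omega>. h (S n \<omega>) :: real)"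
  using indep_var_compose[OF N_indep measurable_ident assms, of n] by (simp add: comp_def S_def)

lemma S_square: "integrable M (\<lambda>\<omega>. (S n \<omega>)\<^sup>2) \<and> expectation (\<lambda>\<omega>. (S n \<omega>)\<^sup>2) = (\<Sum>i<n. v i)"
proof (induction n)
  case (Suc n)
  have ind: "indep_var borel (Y n) borel (S n)"
    using Y_indep[of "{..<n}" n] by (simp add: S_def[abs_def])
  have S_int: "integrable M (S n)"
    using square_integrable_imp_integrable[OF S_measurable] Suc by blast
  note YS = indep_var_integrable[OF ind Y_integrable S_int] indep_var_lebesgue_integral[OF ind Y_integrable S_int]
  have "(\<lambda>\<omega>. (S (Suc n) \<omega>)\<^sup>2) = (\<lambda>\<omega>. (S n \<omega>)\<^sup>2 + (Y n \<omega>)\<^sup>2 + 2 * (Y n \<omega> * S n \<omega>))"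
    by (simp add: S_def power2_eq_square algebra_simps)
  thus ?case
    using Suc Y_square[of n] YS Y_mean[of n] by (simp add: v_def)
qed (simp add: S_def)

lemma S_integrable: "integrable M (S n)"
  using square_integrable_imp_integrable[OF S_measurable] S_square by blast

lemma expectation_indicator_N: "expectation (\<lambda>\<omega>. of_bool (i < N \<omega>)) = q i"
proof -
  have "expectation (\<lambda>\<omega>. of_bool (i < N \<omega>)) = expectation (indicator {\<omega> \<in> space M. i < N \<omega>})"
    by (intro Bochner_Integration.integral_cong) (auto simp: indicator_def)
  also have "\<dots> = q i" unfolding q_def by (subst Bochner_Integration.integral_indicator) (auto intro!: arg_cong[where f = prob])
  finally show ?thesis .
qed

end

text \<open>The triangle inequality for a series that need not converge absolutely: the right side
  may be infinite, as happens when a third moment is.\<close>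

lemma ennreal_abs_sums_le:
  fixes f :: "nat \<Rightarrow> real"
  assumes "f sums x"
  shows "ennreal \<bar>x\<bar> \<le> (\<Sum>i. ennreal \<bar>f i\<bar>)"
proof (rule LIMSEQ_le_const2)
  show "(\<lambda>n. ennreal \<bar>\<Sum>i<n. f i\<bar>) \<longlonglongrightarrow> ennreal \<bar>x\<bar>"
    using assms unfolding sums_def by (intro tendsto_ennrealI tendsto_rabs)
  have "ennreal \<bar>\<Sum>i<n. f i\<bar> \<le> (\<Sum>i. ennreal \<bar>f i\<bar>)" for n
  proof -
    have "ennreal \<bar>\<Sum>i<n. f i\<bar> \<le> ennreal (\<Sum>i<n. \<bar>f i\<bar>)"
      by (intro ennreal_leI sum_abs)
    also have "\<dots> = (\<Sum>i<n. ennreal \<bar>f i\<bar>)"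
      by (rule sum_ennreal[symmetric]) simp
    also have "\<dots> \<le> (\<Sum>i. ennreal \<bar>f i\<bar>)"
      by (rule sum_le_suminf) auto
    finally show ?thesis .
  qed
  thus "\<exists>N. \<forall>n\<ge>N. ennreal \<bar>\<Sum>i<n. f i\<bar> \<le> (\<Sum>i. ennreal \<bar>f i\<bar>)" by blast
qed

lemma ennreal_mult_add_mult:
  assumes "a \<ge> 0" "x \<ge> 0" "y \<ge> 0" "z \<ge> 0"
  shows "ennreal (a * ((x + y) * z)) = ennreal a * ((ennreal x + ennreal y) * ennreal z)"
  using assms by (simp add: ennreal_mult ennreal_plus)

lemma sums_of_suminf_ennreal:
  fixes f :: "nat \<Rightarrow> real"
  assumes "\<And>i. f i \<ge> 0" "x \<ge> 0" "(\<Sum>i. ennreal (f i)) = ennreal x"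
  shows "f sums x"
  using summable_sums[OF summableI, of "\<lambda>i. ennreal (f i)"] assms by (simp add: sums_ennreal)

section \<open>Conditioning on the number of summands\<close>

context random_sum
begin

lemma expectation_random_sum:
  fixes h :: "real \<Rightarrow> real"
  assumes h: "h \<in> borel_measurable borel" and int: "\<And>n. integrable M (\<lambda>\<omega>. h (S n \<omega>))"
    and "integrable M (\<lambda>\<omega>. h (S (N \<omega>) \<omega>))"
  shows "expectation (\<lambda>\<omega>. h (S (N \<omega>) \<omega>)) = expectation (\<lambda>\<omega>. expectation (\<lambda>\<omega>'. h (S (N \<omega>) \<omega>')))"
  by (rule expectation_random_index[OF N_measurable N_indep_comp[OF h] int assms(3)])

text \<open>For a fixed number \<open>n\<close> of summands the second moment is the sum of
  \<open>v i\<close> over \<open>i < n\<close>. Writing the range as an indicator of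
  \<open>i < N\<close> allows expectation and sum to be exchanged by nonnegativity.\<close>

lemma nn_integral_random_sum_square:
  "(\<integral>\<^sup>+\<omega>. ennreal ((S (N \<omega>) \<omega>)\<^sup>2) \<partial>M) = (\<Sum>i. ennreal (v i * q i))"
proof -
  have "(\<integral>\<^sup>+\<omega>. ennreal ((S (N \<omega>) \<omega>)\<^sup>2) \<partial>M) = (\<integral>\<^sup>+\<omega>. ennreal (expectation (\<lambda>\<omega>'. (S (N \<omega>) \<omega>')\<^sup>2)) \<partial>M)"
    using S_square by (intro nn_integral_random_index_expectation N_indep_comp) auto
  also have "\<dots> = (\<integral>\<^sup>+\<omega>. (\<Sum>i. ennreal (v i * of_bool (i < N \<omega>))) \<partial>M)"
  proof (rule nn_integral_cong)
    fix \<omega>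
    have "(\<Sum>i. ennreal (v i * of_bool (i < N \<omega>))) = (\<Sum>i<N \<omega>. ennreal (v i * of_bool (i < N \<omega>)))"
      by (rule suminf_finite) auto
    also have "\<dots> = ennreal (\<Sum>i<N \<omega>. v i)"
      by (subst sum_ennreal[symmetric]) (auto simp: v_nonneg)
    finally show "ennreal (expectation (\<lambda>\<omega>'. (S (N \<omega>) \<omega>')\<^sup>2)) = (\<Sum>i. ennreal (v i * of_bool (i < N \<omega>)))"
      using S_square by simp
  qed
  also have "\<dots> = (\<Sum>i. \<integral>\<^sup>+\<omega>. ennreal (v i * of_bool (i < N \<omega>)) \<partial>M)"
    by (intro nn_integral_suminf measurable_compose_count_space[OF N_measurable, of "\<lambda>n. ennreal (v _ * of_bool (_ < n))"])
  also have "(\<lambda>i. \<integral>\<^sup>+\<omega>. ennreal (v i * of_bool (i < N \<omega>)) \<partial>M) = (\<lambda>i. ennreal (v i * q i))"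
  proof
    fix i
    have "integrable M (\<lambda>\<omega>. of_bool (i < N \<omega>) :: real)"
      by (rule integrable_const_bound[where B = 1]) (auto intro: measurable_compose_count_space[OF N_measurable])
    hence "(\<integral>\<^sup>+\<omega>. ennreal (v i * of_bool (i < N \<omega>)) \<partial>M) = ennreal (expectation (\<lambda>\<omega>. v i * of_bool (i < N \<omega>)))"
      by (intro nn_integral_eq_integral) (auto simp: v_nonneg)
    thus "(\<integral>\<^sup>+\<omega>. ennreal (v i * of_bool (i < N \<omega>)) \<partial>M) = ennreal (v i * q i)"
      by (simp only: integral_mult_right_zero expectation_indicator_N)
  qed
  finally show ?thesis .
qed

context
  assumes W_square: "integrable M (\<lambda>\<omega>. (S (N \<omega>) \<omega>)\<^sup>2)"
begin

lemma random_sum_integrable: "integrable M (\<lambda>\<omega>. S (N \<omega>) \<omega>)"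
  using square_integrable_imp_integrable[OF random_sum_measurable W_square] .

lemma random_sum_mean: "expectation (\<lambda>\<omega>. S (N \<omega>) \<omega>) = 0"
proof -
  have "expectation (S n) = 0" for n
    unfolding S_def[abs_def] using Y_integrable Y_mean by simp
  thus ?thesis
    using expectation_random_sum[of "\<lambda>x. x"] S_integrable random_sum_integrable by simp
qed

lemma random_sum_variance_sums: "(\<lambda>i. v i * q i) sums expectation (\<lambda>\<omega>. (S (N \<omega>) \<omega>)\<^sup>2)"
proof (rule sums_of_suminf_ennreal)
  show "(\<Sum>i. ennreal (v i * q i)) = ennreal (expectation (\<lambda>\<omega>. (S (N \<omega>) \<omega>)\<^sup>2))"
    unfolding nn_integral_random_sum_square[symmetric] using W_square by (intro nn_integral_eq_integral) auto
qed (auto simp: v_nonneg q_nonneg)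

section \<open>The approximate Stein identity for the random sum\<close>

context
  fixes k k' k'' :: "real \<Rightarrow> real" and C L K :: real
  assumes k: "\<And>x. (k has_real_derivative k' x) (at x)" and k': "\<And>x. (k' has_real_derivative k'' x) (at x)"
    and k_le: "\<And>x. \<bar>k x\<bar> \<le> C" and k'_le: "\<And>x. \<bar>k' x\<bar> \<le> L" and k''_le: "\<And>x. \<bar>k'' x\<bar> \<le> K"
begin

private lemma k_measurable: "k \<in> borel_measurable borel" "k' \<in> borel_measurable borel"
  by (intro borel_measurable_continuous_onI continuous_at_imp_continuous_on ballI DERIV_isCont[OF k]
        DERIV_isCont[OF k'])+

private lemma L_nonneg: "L \<ge> 0"
  using k'_le[of 0] by linarith

text \<open>Evaluated at \<open>N \<omega>\<close> with \<open>i < N \<omega>\<close>, this plays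
  the role of the conditional expectation of \<open>Y i * k W\<close> given \<open>N\<close>, as
  \<open>\<kappa>\<close> does for \<open>k' W\<close>. As functions of \<open>n\<close>, both can
  be estimated for a fixed number of summands.\<close>

private definition e :: "nat \<Rightarrow> nat \<Rightarrow> real" where "e i n = expectation (\<lambda>\<omega>. Y i \<omega> * k (S n \<omega>))"

private definition \<kappa> :: "nat \<Rightarrow> real" where "\<kappa> n = expectation (\<lambda>\<omega>. k' (S n \<omega>))"

private definition b :: "nat \<Rightarrow> 'a \<Rightarrow> real" where "b i \<omega> = of_bool (i < N \<omega>)"

private lemma S_split:
  assumes "i < n"
  shows "S n = (\<lambda>\<omega>. Y i \<omega> + (\<Sum>j\<in>{..<n} - {i}. Y j \<omega>))"
  using assms by (auto simp: S_def fun_eq_iff intro!: sum.remove)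

private lemma e_le:
  assumes "i < n" shows "\<bar>e i n\<bar> \<le> L * v i"
  unfolding e_def S_split[OF assms] v_def
  by (rule abs_expectation_centered_mult_le[OF Y_indep Y_square Y_mean k k' k_le k'_le k''_le]) auto

private lemma e_diff_le:
  assumes "i < n" and "integrable M (\<lambda>\<omega>. \<bar>Y i \<omega>\<bar> ^ 3)"
  shows "\<bar>e i n - v i * \<kappa> n\<bar> \<le> K * (expectation (\<lambda>\<omega>. \<bar>Y i \<omega>\<bar> ^ 3) / 2 + v i * expectation (\<lambda>\<omega>. \<bar>Y i \<omega>\<bar>))"
  unfolding e_def \<kappa>_def S_split[OF assms(1)] v_def
  by (rule abs_expectation_centered_mult_diff_le[OF Y_indep Y_square Y_mean k k' k_le k'_le k''_le assms(2)]) auto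

private lemma k_S_measurable [measurable]: "(\<lambda>\<omega>. k (S n \<omega>)) \<in> borel_measurable M" "(\<lambda>\<omega>. k' (S n \<omega>)) \<in> borel_measurable M"
  by (auto intro: measurable_compose[OF S_measurable] k_measurable)

private lemma k_W_measurable [measurable]: "(\<lambda>\<omega>. k (S (N \<omega>) \<omega>)) \<in> borel_measurable M" "(\<lambda>\<omega>. k' (S (N \<omega>) \<omega>)) \<in> borel_measurable M"
  by (auto intro: measurable_compose[OF random_sum_measurable] k_measurable)

private lemma integrable_mult_k:
  assumes "integrable M f" "(\<lambda>\<omega>. k (g \<omega>)) \<in> borel_measurable M"
  shows "integrable M (\<lambda>\<omega>. f \<omega> * k (g \<omega>))"
proof (rule Bochner_Integration.integrable_bound)
  show "integrable M (\<lambda>\<omega>. C * f \<omega>)" using assms(1) by simp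
  have "\<bar>f \<omega>\<bar> * \<bar>k (g \<omega>)\<bar> \<le> \<bar>f \<omega>\<bar> * \<bar>C\<bar>" for \<omega>
    using k_le[of "g \<omega>"] by (intro mult_left_mono) auto
  thus "AE \<omega> in M. norm (f \<omega> * k (g \<omega>)) \<le> norm (C * f \<omega>)"
    by (intro always_eventually) (auto simp: abs_mult mult.commute)
  show "(\<lambda>\<omega>. f \<omega> * k (g \<omega>)) \<in> borel_measurable M"
    using assms by measurable
qed

private lemma \<kappa>_le: "\<bar>\<kappa> n\<bar> \<le> L"
proof -
  have "\<bar>\<kappa> n\<bar> \<le> expectation (\<lambda>_. L)"
    unfolding \<kappa>_def by (rule abs_expectation_le) (use k'_le in auto)
  thus ?thesis by (simp add: prob_space)
qed

private lemma expectation_k'_W: "expectation (\<lambda>\<omega>. k' (S (N \<omega>) \<omega>)) = expectation (\<lambda>\<omega>. \<kappa> (N \<omega>))"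
  unfolding \<kappa>_def
  by (rule expectation_random_sum[OF k_measurable(2)]; rule integrable_const_bound[where B = L]; use k'_le in auto)

private lemma b_e_le: "\<bar>b i \<omega> * e i (N \<omega>)\<bar> \<le> L * v i * b i \<omega>"
  using e_le[of i "N \<omega>"] by (simp add: b_def)

private lemma b_measurable [measurable]: "b i \<in> borel_measurable M"
  unfolding b_def[abs_def] by (rule measurable_compose_count_space[OF N_measurable])

private lemma e_N_measurable [measurable]: "(\<lambda>\<omega>. e i (N \<omega>)) \<in> borel_measurable M"
  by (rule measurable_compose_count_space[OF N_measurable])

private lemma \<kappa>_N_measurable [measurable]: "(\<lambda>\<omega>. \<kappa> (N \<omega>)) \<in> borel_measurable M"
  by (rule measurable_compose_count_space[OF N_measurable])

private lemma b_integrable: "integrable M (b i)"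
  by (rule integrable_const_bound[where B = 1]) (auto simp: b_def)

private lemma expectation_b: "expectation (b i) = q i"
  unfolding b_def[abs_def] by (rule expectation_indicator_N)

private lemma b_e_integrable: "integrable M (\<lambda>\<omega>. b i \<omega> * e i (N \<omega>))"
proof (rule Bochner_Integration.integrable_bound)
  show "integrable M (\<lambda>\<omega>. L * v i * b i \<omega>)" using b_integrable by simp
qed (use order_trans[OF b_e_le abs_ge_self] in \<open>auto intro!: always_eventually\<close>)

text \<open>For fixed \<open>n\<close> the expectation is a finite sum of \<open>e i n\<close>; its
  range is moved into the factor \<open>b i\<close> so that it no longer depends on
  \<open>N\<close>. The exchange with the expectation is dominated by \<open>L * v i * q i\<close>,
  which is summable since \<open>W\<close> has finite variance.\<close>

private lemma expectation_W_k_W_sums: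
  "(\<lambda>i. expectation (\<lambda>\<omega>. b i \<omega> * e i (N \<omega>))) sums expectation (\<lambda>\<omega>. S (N \<omega>) \<omega> * k (S (N \<omega>) \<omega>))"
proof -
  have Sk: "expectation (\<lambda>\<omega>'. S n \<omega>' * k (S n \<omega>')) = (\<Sum>i. of_bool (i < n) * e i n)" for n
  proof -
    have "(\<lambda>\<omega>'. S n \<omega>' * k (S n \<omega>')) = (\<lambda>\<omega>'. \<Sum>i<n. Y i \<omega>' * k (S n \<omega>'))"
      by (simp add: sum_distrib_right[symmetric]) (simp add: S_def)
    hence "expectation (\<lambda>\<omega>'. S n \<omega>' * k (S n \<omega>')) = (\<Sum>i<n. e i n)"
      unfolding e_def by (simp add: integrable_mult_k Y_integrable)
    also have "\<dots> = (\<Sum>i<n. of_bool (i < n) * e i n)" by simp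
    also have "\<dots> = (\<Sum>i. of_bool (i < n) * e i n)"
      by (rule suminf_finite[symmetric]) auto
    finally show ?thesis .
  qed
  have "expectation (\<lambda>\<omega>. S (N \<omega>) \<omega> * k (S (N \<omega>) \<omega>)) = expectation (\<lambda>\<omega>. expectation (\<lambda>\<omega>'. S (N \<omega>) \<omega>' * k (S (N \<omega>) \<omega>')))"
    using k_measurable
    by (intro expectation_random_sum[of "\<lambda>x. x * k x"] integrable_mult_k S_integrable random_sum_integrable) auto
  also have "\<dots> = expectation (\<lambda>\<omega>. \<Sum>i. of_bool (i < N \<omega>) * e i (N \<omega>))"
    unfolding Sk ..
  finally have eq: "expectation (\<lambda>\<omega>. S (N \<omega>) \<omega> * k (S (N \<omega>) \<omega>)) = expectation (\<lambda>\<omega>. \<Sum>i. of_bool (i < N \<omega>) * e i (N \<omega>))" .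
  have "expectation (\<lambda>\<omega>. \<Sum>i. of_bool (i < N \<omega>) * e i (N \<omega>)) = (\<Sum>i. expectation (\<lambda>\<omega>. b i \<omega> * e i (N \<omega>)))
      \<and> summable (\<lambda>i. expectation (\<lambda>\<omega>. b i \<omega> * e i (N \<omega>)))"
  proof -
    have 1: "AE \<omega> in M. summable (\<lambda>i. norm (b i \<omega> * e i (N \<omega>)))"
      by (intro always_eventually allI summable_finite[of "{..<N _}"]) (auto simp: b_def)
    have le: "expectation (\<lambda>\<omega>. norm (b i \<omega> * e i (N \<omega>))) \<le> L * (v i * q i)" for i
    proof -
      have "expectation (\<lambda>\<omega>. norm (b i \<omega> * e i (N \<omega>))) \<le> expectation (\<lambda>\<omega>. L * v i * b i \<omega>)"
        using b_e_integrable b_integrable b_e_le by (intro integral_mono) auto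
      thus ?thesis by (simp add: expectation_b)
    qed
    have 2: "summable (\<lambda>i. expectation (\<lambda>\<omega>. norm (b i \<omega> * e i (N \<omega>))))"
    proof (rule summable_comparison_test'[where N = 0])
      show "summable (\<lambda>i. L * (v i * q i))"
        by (rule summable_mult[OF sums_summable[OF random_sum_variance_sums]])
      show "norm (expectation (\<lambda>\<omega>. norm (b i \<omega> * e i (N \<omega>)))) \<le> L * (v i * q i)" for i
        using le[of i] by (subst real_norm_def, subst abs_of_nonneg) (auto intro: integral_nonneg)
    qed
    show ?thesis
      using integral_suminf[OF b_e_integrable 1 2] summable_integral[OF b_e_integrable 1 2]
      by (simp add: b_def)
  qed
  thus ?thesis
    unfolding eq by (simp add: sums_iff)
qed

text \<open>Both expectations on the left expand into series over the summands, the second by the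
  variance formula, so the difference can be bounded term by term.\<close>

lemma random_sum_stein_bound:
  assumes K: "K > 0"
  shows "ennreal \<bar>expectation (\<lambda>\<omega>. S (N \<omega>) \<omega> * k (S (N \<omega>) \<omega>))
      - expectation (\<lambda>\<omega>. (S (N \<omega>) \<omega>)\<^sup>2) * expectation (\<lambda>\<omega>. k' (S (N \<omega>) \<omega>))\<bar>
    \<le> (\<Sum>i. ennreal (K / 2) * (((\<integral>\<^sup>+\<omega>. ennreal (\<bar>Y i \<omega>\<bar> ^ 3) \<partial>M)
          + ennreal (2 * v i * expectation (\<lambda>\<omega>. \<bar>Y i \<omega>\<bar>))) * ennreal (q i ^ 2))
        + ennreal (2 * L * (v i * q i * (1 - q i))))"
proof -
  \<comment> \<open>With \<open>W\<close> for the random sum, \<open>A1 i\<close> and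
    \<open>A2 i\<close> stand for the expectations of \<open>Y i * k W\<close> and
    \<open>k' W\<close> on the event \<open>i < N\<close>, and \<open>A3 i\<close> for that of
    \<open>k' W\<close> on its complement.\<close>
  define A1 where "A1 i = expectation (\<lambda>\<omega>. b i \<omega> * e i (N \<omega>))" for i
  define A2 where "A2 i = expectation (\<lambda>\<omega>. b i \<omega> * \<kappa> (N \<omega>))" for i
  define A3 where "A3 i = expectation (\<lambda>\<omega>. (1 - b i \<omega>) * \<kappa> (N \<omega>))" for i
  define \<kappa>' where "\<kappa>' = expectation (\<lambda>\<omega>. k' (S (N \<omega>) \<omega>))"
  define T where "T i = A1 i - v i * q i * \<kappa>'" for i
  have \<kappa>_int: "integrable M (\<lambda>\<omega>. \<kappa> (N \<omega>))"
    by (rule integrable_const_bound[where B = L]) (use \<kappa>_le in auto)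
  have b\<kappa>_int: "integrable M (\<lambda>\<omega>. b i \<omega> * \<kappa> (N \<omega>))" for i
    by (rule integrable_const_bound[where B = L]) (use \<kappa>_le L_nonneg in \<open>auto simp: b_def\<close>)
  have "T sums (expectation (\<lambda>\<omega>. S (N \<omega>) \<omega> * k (S (N \<omega>) \<omega>)) - expectation (\<lambda>\<omega>. (S (N \<omega>) \<omega>)\<^sup>2) * \<kappa>')"
    unfolding T_def A1_def
    by (intro sums_diff expectation_W_k_W_sums sums_mult2 random_sum_variance_sums)
  from ennreal_abs_sums_le[OF this]
  have "ennreal \<bar>expectation (\<lambda>\<omega>. S (N \<omega>) \<omega> * k (S (N \<omega>) \<omega>)) - expectation (\<lambda>\<omega>. (S (N \<omega>) \<omega>)\<^sup>2) * \<kappa>'\<bar>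
      \<le> (\<Sum>i. ennreal \<bar>T i\<bar>)" .
  also have "\<dots> \<le> (\<Sum>i. ennreal (K / 2) * (((\<integral>\<^sup>+\<omega>. ennreal (\<bar>Y i \<omega>\<bar> ^ 3) \<partial>M)
          + ennreal (2 * v i * expectation (\<lambda>\<omega>. \<bar>Y i \<omega>\<bar>))) * ennreal (q i ^ 2))
        + ennreal (2 * L * (v i * q i * (1 - q i))))"
  proof (intro suminf_le allI summableI)
    fix i
    have events: "{\<omega> \<in> space M. i < N \<omega>} \<in> events" by measurable
    have A1_le: "\<bar>A1 i\<bar> \<le> L * v i * q i"
      unfolding A1_def q_def
      by (rule abs_expectation_le_prob[OF events]) (use e_le in \<open>auto simp: b_def indicator_def\<close>)
    have "\<bar>A3 i\<bar> \<le> L * prob (space M - {\<omega> \<in> space M. i < N \<omega>})"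
      unfolding A3_def by (rule abs_expectation_le_prob) (use \<kappa>_le events in \<open>auto simp: b_def indicator_def\<close>)
    hence A3_le: "\<bar>A3 i\<bar> \<le> L * (1 - q i)"
      unfolding prob_compl[OF events] q_def .
    have "\<kappa>' = A2 i + A3 i"
      unfolding \<kappa>'_def expectation_k'_W A2_def A3_def using \<kappa>_int b\<kappa>_int[of i] by (simp add: left_diff_distrib)
    \<comment> \<open>\<open>A1 i\<close> is split with weights \<open>q i\<close> and
      \<open>1 - q i\<close>. Only the first portion is compared with \<open>v i * A2 i\<close>;
      that comparison already carries a factor \<open>q i\<close>, whence the square. The other two
      terms are each at most \<open>L * v i * q i * (1 - q i)\<close>.\<close>
    hence T_eq: "T i = q i * (A1 i - v i * A2 i) + (1 - q i) * A1 i - q i * v i * A3 i"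
      unfolding T_def by (simp add: algebra_simps)
    have "\<bar>T i\<bar> \<le> \<bar>q i * (A1 i - v i * A2 i)\<bar> + \<bar>(1 - q i) * A1 i\<bar> + \<bar>q i * v i * A3 i\<bar>"
      unfolding T_eq by linarith
    also have "\<dots> = q i * \<bar>A1 i - v i * A2 i\<bar> + (1 - q i) * \<bar>A1 i\<bar> + q i * v i * \<bar>A3 i\<bar>"
      using q_nonneg[of i] q_le_1[of i] v_nonneg[of i] by (simp add: abs_mult)
    also have "\<dots> \<le> q i * \<bar>A1 i - v i * A2 i\<bar> + (1 - q i) * (L * v i * q i) + q i * v i * (L * (1 - q i))"
      using q_nonneg[of i] q_le_1[of i] v_nonneg[of i] by (intro add_mono mult_left_mono A1_le A3_le) auto
    finally have T_le: "\<bar>T i\<bar> \<le> q i * \<bar>A1 i - v i * A2 i\<bar> + 2 * L * (v i * q i * (1 - q i))"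
      by (simp add: algebra_simps)
    have main: "ennreal (q i * \<bar>A1 i - v i * A2 i\<bar>)
        \<le> ennreal (K / 2) * (((\<integral>\<^sup>+\<omega>. ennreal (\<bar>Y i \<omega>\<bar> ^ 3) \<partial>M)
          + ennreal (2 * v i * expectation (\<lambda>\<omega>. \<bar>Y i \<omega>\<bar>))) * ennreal (q i ^ 2))"
    \<comment> \<open>If \<open>q i = 0\<close> the left side is 0 whatever the third moment; if
      \<open>q i\<close> is nonzero and that moment infinite, so is the right side.\<close>
    proof (cases "q i = 0 \<or> integrable M (\<lambda>\<omega>. \<bar>Y i \<omega>\<bar> ^ 3)")
      case True
      show ?thesis
      proof (cases "q i = 0")
        case False
        with True have int: "integrable M (\<lambda>\<omega>. \<bar>Y i \<omega>\<bar> ^ 3)" by simp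
        let ?b3 = "expectation (\<lambda>\<omega>. \<bar>Y i \<omega>\<bar> ^ 3)" and ?b1 = "expectation (\<lambda>\<omega>. \<bar>Y i \<omega>\<bar>)"
        have nonneg: "?b3 \<ge> 0" "?b1 \<ge> 0" by (auto intro: integral_nonneg)
        have "A1 i - v i * A2 i = expectation (\<lambda>\<omega>. b i \<omega> * e i (N \<omega>) - v i * (b i \<omega> * \<kappa> (N \<omega>)))"
          unfolding A1_def A2_def using b_e_integrable b\<kappa>_int by simp
        also have "\<bar>\<dots>\<bar> \<le> K * (?b3 / 2 + v i * ?b1) * prob {\<omega> \<in> space M. i < N \<omega>}"
          by (rule abs_expectation_le_prob[OF events])
             (use e_diff_le[OF _ int] in \<open>auto simp: b_def indicator_def\<close>)
        finally have "\<bar>A1 i - v i * A2 i\<bar> \<le> K * (?b3 / 2 + v i * ?b1) * q i"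
          unfolding q_def .
        hence "q i * \<bar>A1 i - v i * A2 i\<bar> \<le> q i * (K * (?b3 / 2 + v i * ?b1) * q i)"
          using q_nonneg[of i] by (intro mult_left_mono)
        also have "\<dots> = K / 2 * ((?b3 + 2 * v i * ?b1) * q i ^ 2)"
          by (simp add: power2_eq_square field_simps)
        finally have "ennreal (q i * \<bar>A1 i - v i * A2 i\<bar>) \<le> ennreal (K / 2 * ((?b3 + 2 * v i * ?b1) * q i ^ 2))"
          by (rule ennreal_leI)
        also have "\<dots> = ennreal (K / 2) * ((ennreal ?b3 + ennreal (2 * v i * ?b1)) * ennreal (q i ^ 2))"
          by (rule ennreal_mult_add_mult) (use nonneg K v_nonneg[of i] in auto)
        also have "ennreal ?b3 = (\<integral>\<^sup>+\<omega>. ennreal (\<bar>Y i \<omega>\<bar> ^ 3) \<partial>M)"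
          using int by (intro nn_integral_eq_integral[symmetric]) auto
        finally show ?thesis .
      qed simp
    next
      case False
      hence "(\<integral>\<^sup>+\<omega>. ennreal (\<bar>Y i \<omega>\<bar> ^ 3) \<partial>M) = \<infinity>"
        by (auto simp: integrable_iff_bounded less_top[symmetric])
      moreover have "ennreal (q i ^ 2) \<noteq> 0" "ennreal (K / 2) \<noteq> 0"
        using False K q_nonneg[of i] by auto
      ultimately show ?thesis by (simp add: ennreal_top_mult ennreal_mult_top)
    qed
    have "ennreal \<bar>T i\<bar> \<le> ennreal (q i * \<bar>A1 i - v i * A2 i\<bar>) + ennreal (2 * L * (v i * q i * (1 - q i)))"
      using ennreal_leI[OF T_le] q_nonneg[of i] q_le_1[of i] v_nonneg[of i] L_nonneg
      by (simp add: ennreal_plus[symmetric] del: ennreal_plus)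
    also have "\<dots> \<le> ennreal (K / 2) * (((\<integral>\<^sup>+\<omega>. ennreal (\<bar>Y i \<omega>\<bar> ^ 3) \<partial>M)
          + ennreal (2 * v i * expectation (\<lambda>\<omega>. \<bar>Y i \<omega>\<bar>))) * ennreal (q i ^ 2))
        + ennreal (2 * L * (v i * q i * (1 - q i)))"
      by (intro add_right_mono main)
    finally show "ennreal \<bar>T i\<bar> \<le> \<dots>" .
  qed
  finally show ?thesis unfolding \<kappa>'_def .
qed

end

end

end

section \<open>The rescaled Stein solution and the law of the random index\<close>

theorem corollary2p5:
  fixes M :: "'a measure" and M' :: "'b measure"
    and X :: "nat \<Rightarrow> 'a \<Rightarrow> real" and \<sigma> :: "nat \<Rightarrow> real"
    and N I :: "'a \<Rightarrow> nat" and W :: "'a \<Rightarrow> real" and s :: real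
    and Z :: "'b \<Rightarrow> real"
  assumes "prob_space M"
    and X_indep: "prob_space.indep_vars M (\<lambda>_. borel) X {1..}"
    and X_square: "\<And>i. i \<ge> 1 \<Longrightarrow> integrable M (\<lambda>\<omega>. (X i \<omega>)\<^sup>2)"
    and X_mean: "\<And>i. i \<ge> 1 \<Longrightarrow> prob_space.expectation M (X i) = 0"
    and X_var: "\<And>i. i \<ge> 1 \<Longrightarrow> prob_space.variance M (X i) = (\<sigma> i)\<^sup>2"
    and N_indep: "indep_elements M (count_space UNIV) N
                    (\<Pi>\<^sub>M i\<in>{1..}. borel) (\<lambda>\<omega>. \<lambda>i\<in>{1..}. X i \<omega>)"
    and W_def: "\<And>\<omega>. W \<omega> = (\<Sum>i=1..N \<omega>. X i \<omega>)"
    and W_square: "integrable M (\<lambda>\<omega>. (W \<omega>)\<^sup>2)"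
    and s_pos: "s > 0"
    and s_var: "s\<^sup>2 = prob_space.variance M W"
    and I_ge: "\<And>\<omega>. \<omega> \<in> space M \<Longrightarrow> I \<omega> \<ge> 1"
    and I_indep: "indep_elements M (count_space UNIV) I
                    (count_space UNIV \<Otimes>\<^sub>M (\<Pi>\<^sub>M i\<in>{1..}. borel)) (\<lambda>\<omega>. (N \<omega>, \<lambda>i\<in>{1..}. X i \<omega>))"
    and I_law: "\<And>i. i \<ge> 1 \<Longrightarrow> \<P>(\<omega> in M. I \<omega> = i) = (\<sigma> i)\<^sup>2 * \<P>(\<omega> in M. N \<omega> \<ge> i) / s\<^sup>2"
    and "prob_space M'"
    and Z_normal: "distributed M' lborel Z (\<lambda>x. ennreal (std_normal_density x))"
  shows "(\<lambda>i. (\<sigma> (Suc i))\<^sup>2 * \<P>(\<omega> in M. N \<omega> \<ge> Suc i)) sums s\<^sup>2 \<and>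
    wasserstein_dist (distr M borel (\<lambda>\<omega>. W \<omega> / s)) (distr M' borel Z)
      \<le> ennreal (1 / s ^ 3) *
          (\<Sum>i. ((\<integral>\<^sup>+ \<omega>. ennreal (\<bar>X (Suc i) \<omega>\<bar> ^ 3) \<partial>M)
                 + ennreal (2 * (\<sigma> (Suc i))\<^sup>2 * prob_space.expectation M (\<lambda>\<omega>. \<bar>X (Suc i) \<omega>\<bar>)))
                * ennreal (\<P>(\<omega> in M. N \<omega> \<ge> Suc i) ^ 2))
        + ennreal (2 * sqrt (2 / pi) * \<P>(\<omega> in M. N \<omega> < I \<omega>))"
proof -
  interpret prob_space M by fact
  define Y where "Y i = X (Suc i)" for i
  have X_measurable: "X i \<in> borel_measurable M" if "i \<ge> 1" for i
    using X_indep that by (auto simp: indep_vars_def)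
  interpret random_sum M Y N
  proof
    show "integrable M (\<lambda>\<omega>. (Y i \<omega>)\<^sup>2)" "expectation (Y i) = 0" for i
      unfolding Y_def using X_square X_mean by auto
    show "N \<in> measurable M (count_space UNIV)"
      using N_indep by (simp add: indep_elements_def)
    show "indep_var borel (Y i) borel (\<lambda>\<omega>. \<Sum>j\<in>J. Y j \<omega>)" if "finite J" "i \<notin> J" for i J
    proof -
      have "indep_vars (\<lambda>_. borel) X (insert (Suc i) (Suc ` J))"
        by (rule indep_vars_subset[OF X_indep]) auto
      from indep_vars_sum[OF _ _ this] that show ?thesis
        by (auto simp: Y_def[abs_def] sum.reindex)
    qed
    show "indep_var borel (\<lambda>\<omega>. indicator {n} (N \<omega>) :: real) borel (\<lambda>\<omega>. \<Sum>j<n. Y j \<omega>)" for n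
    proof -
      have "(\<lambda>x. \<Sum>j<n. x (Suc j)) \<in> borel_measurable (\<Pi>\<^sub>M i\<in>{1..}. borel :: real measure)"
        by (intro borel_measurable_sum measurable_component_singleton) auto
      from indep_elements_imp_indep_var[OF N_indep _ this, of "indicator {n} :: nat \<Rightarrow> real"]
      show ?thesis by (simp add: Y_def)
    qed
  qed
  have W_eq: "W = (\<lambda>\<omega>. S (N \<omega>) \<omega>)"
    by (simp add: fun_eq_iff W_def S_def Y_def sum.atLeast1_atMost_eq)
  have W_sq: "integrable M (\<lambda>\<omega>. (S (N \<omega>) \<omega>)\<^sup>2)"
    using W_square by (simp add: W_eq)
  have [measurable]: "W \<in> borel_measurable M" unfolding W_eq by simp
  have s2: "expectation (\<lambda>\<omega>. (S (N \<omega>) \<omega>)\<^sup>2) = s\<^sup>2"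
    using s_var random_sum_mean[OF W_sq] by (simp add: W_eq)
  have v_eq: "(\<sigma> (Suc i))\<^sup>2 = v i" for i
    using X_var[of "Suc i"] X_mean[of "Suc i"] by (simp add: v_def Y_def)
  have q_eq: "\<P>(\<omega> in M. N \<omega> \<ge> Suc i) = q i" for i
    by (simp add: q_def Suc_le_eq)

  \<comment> \<open>Conditioning on \<open>I\<close> gives the sum of
    \<open>P (I = i + 1) * P (N < i + 1)\<close>, whose second factor is \<open>1 - q i\<close>. The
    formula for random indices is applied with the shifted \<open>I\<close> as the index.\<close>
  have P_eq: "ennreal (\<P>(\<omega> in M. N \<omega> < I \<omega>)) = (\<Sum>i. ennreal (v i * q i / s\<^sup>2 * (1 - q i)))"
  proof -
    \<comment> \<open>Truncated subtraction would identify the values 0 and 1; this is harmless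
      because \<open>I \<omega> \<ge> 1\<close> on the whole space.\<close>
    define J where "J \<omega> = I \<omega> - 1" for \<omega>
    define G where "G i \<omega> = (of_bool (N \<omega> < Suc i) :: real)" for i \<omega>
    have I_meas [measurable]: "I \<in> measurable M (count_space UNIV)"
      using I_indep by (simp add: indep_elements_def)
    have [measurable]: "G i \<in> borel_measurable M" for i
      unfolding G_def[abs_def] by (rule measurable_compose_count_space[OF N_measurable])
    have G_int: "integrable M (G i)" for i
      by (rule integrable_const_bound[where B = 1]) (auto simp: G_def)
    have E_G: "expectation (G i) = 1 - q i" for i
    proof -
      have "expectation (\<lambda>\<omega>. of_bool (i < N \<omega>) + G i \<omega>) = q i + expectation (G i)"
        using integrable_const_bound[where B = 1 and f = "\<lambda>\<omega>. of_bool (i < N \<omega>) :: real"]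
          measurable_compose_count_space[OF N_measurable] G_int
        by (subst Bochner_Integration.integral_add) (auto simp: expectation_indicator_N)
      also have "(\<lambda>\<omega>. of_bool (i < N \<omega>) + G i \<omega>) = (\<lambda>_. 1)"
        by (auto simp: G_def fun_eq_iff)
      finally show ?thesis by (simp add: prob_space)
    qed
    have E_J: "expectation (\<lambda>\<omega>. indicator {i} (J \<omega>)) = v i * q i / s\<^sup>2" for i
    proof -
      have "expectation (\<lambda>\<omega>. indicator {i} (J \<omega>)) = expectation (indicator {\<omega> \<in> space M. I \<omega> = Suc i})"
        using I_ge by (intro Bochner_Integration.integral_cong) (force simp: J_def indicator_def)+
      also have "\<dots> = \<P>(\<omega> in M. I \<omega> = Suc i)"
        by (subst Bochner_Integration.integral_indicator) (auto intro!: arg_cong[where f = prob])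
      finally show ?thesis
        using I_law[of "Suc i"] unfolding v_eq q_eq by simp
    qed
    have ind: "indep_var borel (\<lambda>\<omega>. indicator {i} (J \<omega>) :: real) borel (G i)" for i
    proof -
      have "(\<lambda>x. of_bool (fst x < Suc i) :: real) \<in>
          borel_measurable (count_space UNIV \<Otimes>\<^sub>M (\<Pi>\<^sub>M i\<in>{1..}. borel :: real measure))"
        by (rule measurable_compose_count_space[OF measurable_fst])
      from indep_elements_imp_indep_var[OF I_indep _ this, of "\<lambda>m. indicator {i} (m - 1) :: real"]
      show ?thesis by (simp add: G_def[abs_def] J_def)
    qed
    have J_meas: "J \<in> measurable M (count_space UNIV)"
      unfolding J_def[abs_def] by (rule measurable_compose[OF I_meas]) simp
    have J_int: "integrable M (\<lambda>\<omega>. indicator {i} (J \<omega>) :: real)" for i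
      by (rule integrable_const_bound[where B = 1])
         (auto simp: indicator_def intro: measurable_compose_count_space[OF J_meas])
    have "N \<in> borel_measurable M" "I \<in> borel_measurable M"
      using measurable_compose_count_space[OF N_measurable, of "\<lambda>n. n"]
        measurable_compose_count_space[OF I_meas, of "\<lambda>n. n"] by simp_all
    hence less_event: "{\<omega> \<in> space M. N \<omega> < I \<omega>} \<in> events" by measurable
    have "ennreal (\<P>(\<omega> in M. N \<omega> < I \<omega>)) = (\<integral>\<^sup>+\<omega>. indicator {\<omega> \<in> space M. N \<omega> < I \<omega>} \<omega> \<partial>M)"
      using less_event by (simp add: emeasure_eq_measure)
    also have "\<dots> = (\<integral>\<^sup>+\<omega>. ennreal (G (J \<omega>) \<omega>) \<partial>M)"
      using I_ge by (intro nn_integral_cong) (force simp: G_def J_def indicator_def)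
    also have "\<dots> = (\<Sum>i. ennreal (expectation (\<lambda>\<omega>. indicator {i} (J \<omega>)) * expectation (G i)))"
      by (rule nn_integral_random_index[OF J_meas G_int _ indep_var_lebesgue_integral[OF ind J_int G_int]])
         (simp add: G_def)
    finally show ?thesis by (simp only: E_J E_G)
  qed

  let ?D = "wasserstein_dist (distr M borel (\<lambda>\<omega>. W \<omega> / s)) (distr M' borel Z)"
  let ?c = "\<lambda>i. ((\<integral>\<^sup>+ \<omega>. ennreal (\<bar>Y i \<omega>\<bar> ^ 3) \<partial>M)
      + ennreal (2 * v i * expectation (\<lambda>\<omega>. \<bar>Y i \<omega>\<bar>))) * ennreal (q i ^ 2)"
  let ?R = "ennreal (1 / s ^ 3) * (\<Sum>i. ?c i) + ennreal (2 * sqrt (2 / pi) * \<P>(\<omega> in M. N \<omega> < I \<omega>))"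
  have Z_law: "distr M' borel Z = std_normal_distribution"
    using distributed_distr_eq_density[OF Z_normal]
    by (metis distr_cong sets_lborel)
  have "?D \<le> ?R"
  \<comment> \<open>In the finite case the right side becomes a real number \<open>B\<close>, as the
    Stein expectations are bounded by reals.\<close>
  proof (cases "?R = \<infinity>")
    case False
    define B where "B = enn2real ?R"
    have B: "?R = ennreal B"
      using False by (simp add: B_def less_top)
    have "?D \<le> ennreal B"
      unfolding Z_law
    proof (rule wasserstein_dist_std_normal_le)
      show "real_distribution (distr M borel (\<lambda>\<omega>. W \<omega> / s))"
        by (rule real_distribution_distr) simp
      show "integrable (distr M borel (\<lambda>\<omega>. W \<omega> / s)) (\<lambda>x. x)"
        using random_sum_integrable[OF W_sq] by (simp add: integrable_distr_eq W_eq)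
      fix g :: "real \<Rightarrow> real" assume g: "continuous_on UNIV g" "\<And>t. \<bar>g t\<bar> \<le> 1"
      \<comment> \<open>The solution is made a function of \<open>W\<close> instead of
        \<open>W / s\<close>. Each differentiation brings a factor \<open>1 / s\<close>, so the
        bounds become \<open>sqrt (2 / pi) / s\<close> and \<open>2 / s\<^sup>2\<close>.\<close>
      define k where "k x = stein_sol g (x / s)" for x
      define k' where "k' x = stein_deriv g (x / s) / s" for x
      define k'' where "k'' x = (g (x / s) + stein_sol g (x / s) + x / s * stein_deriv g (x / s)) / s\<^sup>2" for x
      have k: "(k has_real_derivative k' x) (at x)" for x
        unfolding k_def[abs_def] k'_def
        by (rule DERIV_cong[OF DERIV_chain2[OF stein_sol_has_derivative[OF g]]])
           (use s_pos in \<open>auto intro!: derivative_eq_intros\<close>)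
      have k': "(k' has_real_derivative k'' x) (at x)" for x
        unfolding k'_def[abs_def] k''_def
        by (rule DERIV_cong[OF DERIV_cdivide[OF DERIV_chain2[OF stein_deriv_has_derivative[OF g]]]])
           (use s_pos in \<open>auto intro!: derivative_eq_intros simp: power2_eq_square\<close>)
      have k_le: "\<bar>k x\<bar> \<le> 1" for x
        unfolding k_def by (rule abs_stein_sol_le[OF g])
      have k'_le: "\<bar>k' x\<bar> \<le> sqrt (2 / pi) / s" for x
        unfolding k'_def using abs_stein_deriv_le[OF g] s_pos by (simp add: divide_right_mono)
      have k''_le: "\<bar>k'' x\<bar> \<le> 2 / s\<^sup>2" for x
        unfolding k''_def using divide_right_mono[OF abs_stein_deriv2_le[OF g, of "x / s"], of "s\<^sup>2"] by simp
      \<comment> \<open>With \<open>V = W / s\<close> and \<open>f = stein_sol g\<close>, the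
        quotient \<open>T / s\<close> is the expectation of \<open>V * f V - f' V\<close>, the
        quantity to be bounded up to sign.\<close>
      define T where "T = expectation (\<lambda>\<omega>. W \<omega> * k (W \<omega>)) - s\<^sup>2 * expectation (\<lambda>\<omega>. k' (W \<omega>))"
      have "2 / s\<^sup>2 > 0" using s_pos by simp
      from random_sum_stein_bound[OF W_sq k k' k_le k'_le k''_le this]
      have T_le: "ennreal \<bar>T\<bar> \<le> (\<Sum>i. ennreal (1 / s\<^sup>2) * ?c i + ennreal (2 * (sqrt (2 / pi) / s) * (v i * q i * (1 - q i))))"
        by (simp add: T_def W_eq s2)
      \<comment> \<open>Inserting \<open>s\<^sup>2 / s\<^sup>2\<close> turns
        \<open>v i * q i\<close> into the probability that \<open>I\<close> equals
        \<open>i + 1\<close>, so that \<open>P_eq\<close> sums the series.\<close>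
      have "ennreal (2 * (sqrt (2 / pi) / s) * (v i * q i * (1 - q i)))
          = ennreal (2 * sqrt (2 / pi) * s) * ennreal (v i * q i / s\<^sup>2 * (1 - q i))" for i
        using s_pos v_nonneg[of i] q_nonneg[of i] q_le_1[of i]
        by (subst ennreal_mult[symmetric]) (auto simp: power2_eq_square)
      hence "(\<Sum>i. ennreal (2 * (sqrt (2 / pi) / s) * (v i * q i * (1 - q i))))
          = ennreal (2 * sqrt (2 / pi) * s * \<P>(\<omega> in M. N \<omega> < I \<omega>))"
        using s_pos by (simp only: ennreal_suminf_cmult P_eq[symmetric]) (subst ennreal_mult, auto)
      with T_le have T_le': "ennreal \<bar>T\<bar> \<le> ennreal (1 / s\<^sup>2) * (\<Sum>i. ?c i)
          + ennreal (2 * sqrt (2 / pi) * s * \<P>(\<omega> in M. N \<omega> < I \<omega>))"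
        by (simp add: suminf_add[OF summableI summableI, symmetric])
      \<comment> \<open>The division by \<open>s\<close> raises \<open>1 / s\<^sup>2\<close> to
        \<open>1 / s ^ 3\<close> in the moment term and cancels the factor \<open>s\<close> before
        \<open>P (N < I)\<close>.\<close>
      have "ennreal (\<bar>T\<bar> / s) = ennreal (1 / s) * ennreal \<bar>T\<bar>"
        using s_pos by (subst ennreal_mult[symmetric]) auto
      also have "\<dots> \<le> ennreal (1 / s) * (ennreal (1 / s\<^sup>2) * (\<Sum>i. ?c i)
          + ennreal (2 * sqrt (2 / pi) * s * \<P>(\<omega> in M. N \<omega> < I \<omega>)))"
        by (intro mult_left_mono T_le') simp
      also have "\<dots> = ennreal (1 / s * (1 / s\<^sup>2)) * (\<Sum>i. ?c i)
          + ennreal (1 / s * (2 * sqrt (2 / pi) * s * \<P>(\<omega> in M. N \<omega> < I \<omega>)))"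
        using s_pos by (subst (1 2) ennreal_mult) (auto simp: distrib_left mult.assoc)
      also have "\<dots> = ?R"
      proof -
        have "1 / s * (1 / s\<^sup>2) = 1 / s ^ 3"
          by (simp add: power2_eq_square power3_eq_cube)
        moreover have "1 / s * (2 * sqrt (2 / pi) * s * p) = 2 * sqrt (2 / pi) * p" for p
          using s_pos by simp
        ultimately show ?thesis by (simp only:)
      qed
      finally have "ennreal (\<bar>T\<bar> / s) \<le> ennreal B" unfolding B .
      hence T_B: "\<bar>T\<bar> / s \<le> B"
        by (subst (asm) ennreal_le_iff) (simp_all add: B_def)
      have [measurable]: "stein_sol g \<in> borel_measurable borel" "stein_deriv g \<in> borel_measurable borel"
        by (intro borel_measurable_continuous_onI continuous_at_imp_continuous_on ballI
            DERIV_isCont[OF stein_sol_has_derivative[OF g]] DERIV_isCont[OF stein_deriv_has_derivative[OF g]])+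
      have int1: "integrable M (\<lambda>\<omega>. stein_deriv g (W \<omega> / s))"
        by (rule integrable_const_bound[where B = "sqrt (2 / pi)"]) (use abs_stein_deriv_le[OF g] in auto)
      have "integrable M W" using random_sum_integrable[OF W_sq] by (simp add: W_eq)
      hence int2: "integrable M (\<lambda>\<omega>. W \<omega> * stein_sol g (W \<omega> / s))"
        by (rule Bochner_Integration.integrable_bound)
           (use abs_stein_sol_le[OF g] in \<open>auto simp: abs_mult mult_left_le\<close>)
      have "(\<integral>x. stein_deriv g x - x * stein_sol g x \<partial>distr M borel (\<lambda>\<omega>. W \<omega> / s))
          = expectation (\<lambda>\<omega>. stein_deriv g (W \<omega> / s) - W \<omega> * stein_sol g (W \<omega> / s) / s)"
        by (subst integral_distr) auto
      also have "\<dots> = expectation (\<lambda>\<omega>. stein_deriv g (W \<omega> / s)) - expectation (\<lambda>\<omega>. W \<omega> * stein_sol g (W \<omega> / s)) / s"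
        using int1 int2 by simp
      also have "\<dots> = - T / s"
        using s_pos by (simp add: T_def k_def k'_def power2_eq_square field_simps)
      also have "\<dots> \<le> \<bar>T\<bar> / s"
        using s_pos by (intro divide_right_mono) auto
      also note T_B
      finally show "(\<integral>x. stein_deriv g x - x * stein_sol g x \<partial>distr M borel (\<lambda>\<omega>. W \<omega> / s)) \<le> B" .
    qed
    thus ?thesis unfolding B .
  qed simp
  thus ?thesis
    using random_sum_variance_sums[OF W_sq] unfolding v_eq q_eq s2 Y_def by blast
qed

end
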